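(* For all sufficiently small $\epsilon>0$ and $c>0$, and every sequence of positive integers $q_1<q_2<\cdots$ with $\lambda_{q_i}^2/\lambda_{q_{i+1}}<\epsilon$ for all $i$, the vector field $U$ on $\mathbb{T}^3$ constructed in the context from $c$ and $(q_j)$ satisfies $$U\in B^{\frac3r-1}_{r,\infty}\qquad\text{for all } 1<r\le\infty .$$
   Context: $\mathbb{T}^3=(\mathbb{R}/2\pi\mathbb{Z})^3$; $\lambda_q=2^q$; Fourier series are written $u=\sum_{k\in\mathbb{Z}^3}\hat u(k)e^{ik\cdot x}$. Construction of $U$. Given $c>0$ and $q_1<q_2<\cdots$, define for $j\ge 1$ the integer lattice blocks $$A_j=\big([(1-c)\lambda_{q_j},(1+c)\lambda_{q_j}]\times[-c\lambda_{q_j},c\lambda_{q_j}]^2\big)\cap\mathbb{Z}^3,$$ $$B_j=\big([-c\lambda_{q_j-1},c\lambda_{q_j-1}]^2\times[(1-c)\lambda_{q_j-1},(1+c)\lambda_{q_j-1}]\big)\cap\mathbb{Z}^3,$$ $$C_j=A_j+B_j,\qquad A_j^*=-A_j,\quad B_j^*=-B_j,\quad C_j^*=-C_j$$ (where $A_j+B_j$ is the sumset). Let $p(\xi)=I-\frac{\xi\otimes\xi}{|\xi|^2}$ be the symbol of the Leray-Hopf projection onto divergence-free fields, and let $\vec e_1(\xi)=p(\xi)\vec e_1$, $\vec e_2(\xi)=p(\xi)\vec e_2$, with $\vec e_1,\vec e_2$ the first two standard basis vectors of $\mathbb{R}^3$. For a set $S$ let $\chi_S$ be its indicator function. Define $$U=\sum_{j\ge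 1}(U_{q_j}+U_{q_j-1}),$$ where $$\widehat{U_{q_j}}(\xi)=\frac{1}{\lambda_{q_j}^2}\Big(\vec e_2(\xi)\chi_{A_j\cup A_j^*}(\xi)+i(\vec e_2(\xi)-\vec e_1(\xi))\chi_{C_j}(\xi)-i(\vec e_2(\xi)-\vec e_1(\xi))\chi_{C_j^*}(\xi)\Big),$$ $$\widehat{U_{q_j-1}}(\xi)=\frac{1}{\lambda_{q_j}^2}\,\vec e_1(\xi)\chi_{B_j\cup B_j^*}(\xi).$$ Besov spaces. Fix a nonnegative radial $\chi\in C_0^\infty(\mathbb{R}^3)$ with $\chi(\xi)=1$ for $|\xi|\le 1/2$ and $\chi(\xi)=0$ for $|\xi|\ge 1$. Put $\varphi(\xi)=\chi(\xi/2)-\chi(\xi)$, $\varphi_q(\xi)=\varphi(\lambda_q^{-1}\xi)$ for $q\ge 0$, $\varphi_{-1}=\chi$. For a distribution $v$ on $\mathbb{T}^3$, let $\Delta_q v=\sum_{k\in\mathbb{Z}^3}\hat v(k)\varphi_q(k)e^{ik\cdot x}$ for $q\ge -1$. Then $v\in B^s_{r,\infty}$ iff $\|v\|_{B^s_{r,\infty}}=\sup_{q\ge -1}\lambda_q^{s}\|\Delta_q v\|_{L^r(\mathbb{T}^3)}<\infty$ (with $3/r=0$ when $r=\infty$). *)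

theory Defs
  imports "HOL-Probability.Essential_Supremum"
begin

section \<open>Smooth functions, test functions and distributions on the torus\<close>

text \<open>Functions on the torus are functions on \<open>real^3\<close> that are \<open>2\<pi>\<close>-periodic in each coordinate.\<close>

primrec Ck :: "nat \<Rightarrow> ('a::real_normed_vector \<Rightarrow> 'b::real_normed_vector) \<Rightarrow> bool" where
  "Ck 0 f \<longleftrightarrow> continuous_on UNIV f"
| "Ck (Suc n) f \<longleftrightarrow> (\<forall>x. f differentiable (at x)) \<and>
     (\<forall>v. Ck n (\<lambda>x. frechet_derivative f (at x) v))"

definition smooth :: "('a::real_normed_vector \<Rightarrow> 'b::real_normed_vector) \<Rightarrow> bool" where
  "smooth f \<longleftrightarrow> (\<forall>n. Ck n f)"

definition partial :: "3 \<Rightarrow> (real^3 \<Rightarrow> complex) \<Rightarrow> real^3 \<Rightarrow> complex" where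
  "partial i f x = frechet_derivative f (at x) (axis i 1)"

definition test_functions :: "(real^3 \<Rightarrow> complex) set" where
  "test_functions = {f. smooth f \<and> (\<forall>x i. f (x + axis i (2 * pi)) = f x)}"

definition cn_norm :: "nat \<Rightarrow> (real^3 \<Rightarrow> complex) \<Rightarrow> real" where
  "cn_norm n f = (SUP (is, x) \<in> {is. length is \<le> n} \<times> UNIV. norm (foldr partial is f x))"

text \<open>Vector-valued distributions: complex-linear functionals on the test functions, with values in
  \<open>complex^3\<close>, of finite order. (Finite order is continuity for the Frechet topology
  given by the seminorms \<open>cn_norm n\<close>.) Only the values on \<open>test_functions\<close> are relevant.\<close>

type_synonym functional = "(real^3 \<Rightarrow> complex) \<Rightarrow> complex^3"

definition is_distribution :: "functional \<Rightarrow> bool" where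
  "is_distribution v \<longleftrightarrow>
     (\<forall>f\<in>test_functions. \<forall>g\<in>test_functions. v (\<lambda>x. f x + g x) = v f + v g) \<and>
     (\<forall>f\<in>test_functions. \<forall>a. v (\<lambda>x. a * f x) = a *s v f) \<and>
     (\<exists>n C. \<forall>f\<in>test_functions. norm (v f) \<le> C * cn_norm n f)"

definition torus :: "(real^3) measure" where
  "torus = lebesgue_on (cbox 0 (\<chi> i. 2 * pi))"

definition distribution_of :: "(real^3 \<Rightarrow> complex^3) \<Rightarrow> functional" where
  "distribution_of u f = (LINT x|torus. f x *s u x)"

section \<open>Fourier series\<close>

definition of_lattice :: "int^3 \<Rightarrow> real^3" where
  "of_lattice k = (\<chi> i. real_of_int (k $ i))"

definition fourier_coeff :: "functional \<Rightarrow> int^3 \<Rightarrow> complex^3" where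
  "fourier_coeff v k = (1 / (2 * pi) ^ 3) *\<^sub>R v (\<lambda>x. cis (- (of_lattice k \<bullet> x)))"

text \<open>Only used for coefficients of finite support.\<close>
definition fourier_series :: "(int^3 \<Rightarrow> complex^3) \<Rightarrow> real^3 \<Rightarrow> complex^3" where
  "fourier_series a x = (\<Sum>\<^sub>\<infinity>k. cis (of_lattice k \<bullet> x) *s a k)"

section \<open>Besov spaces\<close>

definition lam :: "int \<Rightarrow> real" where
  "lam q = 2 powi q"

definition lp_cutoff :: "(real^3 \<Rightarrow> real) \<Rightarrow> bool" where
  "lp_cutoff chi \<longleftrightarrow> smooth chi \<and> (\<forall>\<xi>. 0 \<le> chi \<xi>) \<and>
     (\<forall>\<xi> \<eta>. norm \<xi> = norm \<eta> \<longrightarrow> chi \<xi> = chi \<eta>) \<and>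
     (\<forall>\<xi>. norm \<xi> \<le> 1 / 2 \<longrightarrow> chi \<xi> = 1) \<and>
     (\<forall>\<xi>. norm \<xi> \<ge> 1 \<longrightarrow> chi \<xi> = 0)"

definition lp_phi :: "(real^3 \<Rightarrow> real) \<Rightarrow> int \<Rightarrow> real^3 \<Rightarrow> real" where
  "lp_phi chi q \<xi> =
     (if q = -1 then chi \<xi>
      else chi (((1 / lam q) *\<^sub>R \<xi>) /\<^sub>R 2) - chi ((1 / lam q) *\<^sub>R \<xi>))"

definition lp_block :: "(real^3 \<Rightarrow> real) \<Rightarrow> int \<Rightarrow> functional \<Rightarrow> real^3 \<Rightarrow> complex^3" where
  "lp_block chi q v =
     fourier_series (\<lambda>k. lp_phi chi q (of_lattice k) *\<^sub>R fourier_coeff v k)"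

definition Lr_norm :: "ennreal \<Rightarrow> (real^3 \<Rightarrow> complex^3) \<Rightarrow> ennreal" where
  "Lr_norm r u =
     (if r = \<infinity> then esssup torus (\<lambda>x. ennreal (norm (u x)))
      else let I = (\<integral>\<^sup>+ x. ennreal (norm (u x) powr enn2real r) \<partial>torus)
           in if I = \<infinity> then \<infinity> else ennreal (enn2real I powr (1 / enn2real r)))"

definition besov_norm :: "(real^3 \<Rightarrow> real) \<Rightarrow> real \<Rightarrow> ennreal \<Rightarrow> functional \<Rightarrow> ennreal" where
  "besov_norm chi s r v =
     (SUP q\<in>{-1..}. ennreal (lam q powr s) * Lr_norm r (lp_block chi q v))"

definition besov :: "(real^3 \<Rightarrow> real) \<Rightarrow> real \<Rightarrow> ennreal \<Rightarrow> functional set" where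
  "besov chi s r = {v. is_distribution v \<and> besov_norm chi s r v < \<infinity>}"

section \<open>The vector field\<close>

definition leray :: "real^3 \<Rightarrow> real^3^3" where
  "leray \<xi> = mat 1 - (\<chi> i j. \<xi> $ i * \<xi> $ j / (norm \<xi>)\<^sup>2)"

definition leray_e :: "3 \<Rightarrow> int^3 \<Rightarrow> complex^3" where
  "leray_e m k = (\<chi> i. complex_of_real ((leray (of_lattice k) *v axis m 1) $ i))"

text \<open>The sequence \<open>q\<close> is indexed from \<open>0\<close>.\<close>

definition blockA :: "real \<Rightarrow> (nat \<Rightarrow> nat) \<Rightarrow> nat \<Rightarrow> (int^3) set" where
  "blockA c q j = (let l = lam (int (q j)) in
     {k. real_of_int (k $ 1) \<in> {(1 - c) * l..(1 + c) * l} \<and>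
         real_of_int (k $ 2) \<in> {- c * l..c * l} \<and>
         real_of_int (k $ 3) \<in> {- c * l..c * l}})"

definition blockB :: "real \<Rightarrow> (nat \<Rightarrow> nat) \<Rightarrow> nat \<Rightarrow> (int^3) set" where
  "blockB c q j = (let l = lam (int (q j) - 1) in
     {k. real_of_int (k $ 1) \<in> {- c * l..c * l} \<and>
         real_of_int (k $ 2) \<in> {- c * l..c * l} \<and>
         real_of_int (k $ 3) \<in> {(1 - c) * l..(1 + c) * l}})"

definition blockC :: "real \<Rightarrow> (nat \<Rightarrow> nat) \<Rightarrow> nat \<Rightarrow> (int^3) set" where
  "blockC c q j = {a + b | a b. a \<in> blockA c q j \<and> b \<in> blockB c q j}"

definition coeffs_U_q :: "real \<Rightarrow> (nat \<Rightarrow> nat) \<Rightarrow> nat \<Rightarrow> int^3 \<Rightarrow> complex^3" where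
  "coeffs_U_q c q j k = (1 / (lam (int (q j)))\<^sup>2) *\<^sub>R
     (indicator (blockA c q j \<union> uminus ` blockA c q j) k *s leray_e 2 k
      + (\<i> * indicator (blockC c q j) k) *s (leray_e 2 k - leray_e 1 k)
      - (\<i> * indicator (uminus ` blockC c q j) k) *s (leray_e 2 k - leray_e 1 k))"

definition coeffs_U_q_minus_1 :: "real \<Rightarrow> (nat \<Rightarrow> nat) \<Rightarrow> nat \<Rightarrow> int^3 \<Rightarrow> complex^3" where
  "coeffs_U_q_minus_1 c q j k = (1 / (lam (int (q j)))\<^sup>2) *\<^sub>R
     (indicator (blockB c q j \<union> uminus ` blockB c q j) k *s leray_e 1 k)"

text \<open>The series defining \<open>U\<close> is summed in the sense of distributions, i.e. after pairing with
  a test function. It converges for lacunary \<open>q\<close>, the \<open>L\<^sup>2\<close> norm of the \<open>j\<close>-th term being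
  of order \<open>lam (q j) powr (-1/2)\<close>; it need not converge pointwise.\<close>

definition U :: "real \<Rightarrow> (nat \<Rightarrow> nat) \<Rightarrow> functional" where
  "U c q f = (\<Sum>j. distribution_of
     (\<lambda>x. fourier_series (coeffs_U_q c q j) x + fourier_series (coeffs_U_q_minus_1 c q j) x) f)"

end

theory Submission imports Defs begin

text \<open>
  Write \<open>u\<^sub>j\<close> for the \<open>j\<close>-th term of the series defining the vector field and \<open>l = lam (q j)\<close> for its
  scale. Its frequencies have size between \<open>l / 4\<close> and \<open>2 l\<close> (lemma \<open>layer_frequencies\<close>). The scales
  grow so fast that every Littlewood-Paley block at scale \<open>L = lam p\<close> sees at most one \<open>u\<^sub>j\<close>, and then
  \<open>l\<close> is comparable to \<open>L\<close> (lemma \<open>lp_block_U\<close>). So the task is to bound the \<open>L\<^sup>r\<close> norm of a single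
  localized term by a constant times \<open>L\<close> to the power \<open>1 - 3 / r\<close>, uniformly in \<open>L\<close>.

  Such a term is, up to the factor \<open>1 / l\<^sup>2\<close>, a combination of a fixed number of exponential sums over
  lattice boxes (a sumset of two boxes is again a box) with side at most \<open>L\<close>, weighted by the Leray
  symbol times the cutoff. The weight is a fixed smooth compactly supported function \<open>g\<close> evaluated at
  \<open>k / L\<close>, since the cutoff vanishes near the singularity of the symbol (lemma \<open>leray_multiplier\<close>).
  Hence a mixed difference of order \<open>n\<close>, for any subset of the three coordinate directions, is
  \<open>O(1 / L\<^sup>n)\<close> (lemma \<open>fdiffs_bound\<close>), and summation by parts in each coordinate bounds the weighted
  sum by a product of three one-dimensional Dirichlet kernels (lemma \<open>exponential_sum_bound\<close>). This
  pointwise bound, which replaces the theory of Fourier multipliers on \<open>L\<^sup>r\<close>, gives the result for all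
  \<open>r > 1\<close> at once: the kernels are at most of order \<open>L\<close>, and the \<open>r\<close>-th power of each of them has
  integral \<open>O(L powr (r - 1))\<close> (lemmas \<open>nn_integral_peak_powr\<close> and \<open>Lr_norm_peak_product\<close>).

  The same bound with \<open>r = 2\<close> and a cutoff equal to \<open>1\<close> on the frequencies of \<open>u\<^sub>j\<close> shows that the
  \<open>L\<^sup>1\<close> norm of \<open>u\<^sub>j\<close> is \<open>O(l powr (- 1 / 2))\<close>. The series therefore converges in the sense of
  distributions, to a distribution of order zero (lemma \<open>U_is_distribution\<close>).
\<close>

section \<open>Calculus of functions of class Ck\<close>

lemma Ck_const: "Ck n (\<lambda>x. c)"
  by (induction n arbitrary: c) (auto simp: frechet_derivative_const)

lemma Ck_mono_Suc: "Ck (Suc n) f \<Longrightarrow> Ck n f"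
proof (induction n arbitrary: f)
  case 0
  then show ?case
    by (auto intro!: continuous_at_imp_continuous_on differentiable_imp_continuous_within)
next
  case (Suc n)
  then show ?case by (metis Ck.simps(2))
qed

lemma Ck_cong_deriv:
  assumes "\<And>x. (f has_derivative f' x) (at x)" "\<And>v. Ck n (\<lambda>x. f' x v)"
  shows "Ck (Suc n) f"
proof -
  have "frechet_derivative f (at x) = f' x" for x
    using frechet_derivative_at[OF assms(1)] by simp
  then show ?thesis
    using assms by (auto simp: differentiable_def)
qed

lemma Ck_SucD:
  assumes "Ck (Suc n) f"
  shows "(f has_derivative frechet_derivative f (at x)) (at x)" "Ck n (\<lambda>x. frechet_derivative f (at x) v)"
    "Ck n f"
  using assms Ck_mono_Suc[OF assms] by (auto simp: frechet_derivative_works)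

lemma Ck_bounded_linear:
  assumes "bounded_linear f" shows "Ck n f"
proof (cases n)
  case 0
  then show ?thesis using assms by (simp add: linear_continuous_on)
next
  case (Suc k)
  show ?thesis unfolding Suc
    by (rule Ck_cong_deriv[where f' = "\<lambda>x. f"])
       (use assms in \<open>auto simp: Ck_const bounded_linear_imp_has_derivative\<close>)
qed

lemma Ck_add: "Ck n f \<Longrightarrow> Ck n g \<Longrightarrow> Ck n (\<lambda>x. f x + g x)"
proof (induction n arbitrary: f g)
  case 0
  then show ?case by (auto intro: continuous_intros)
next
  case (Suc n)
  show ?case
    by (rule Ck_cong_deriv[OF has_derivative_add[OF Ck_SucD(1)[OF Suc.prems(1)] Ck_SucD(1)[OF Suc.prems(2)]]])
       (rule Suc.IH[OF Ck_SucD(2)[OF Suc.prems(1)] Ck_SucD(2)[OF Suc.prems(2)]])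
qed

lemma Ck_mult:
  fixes f g :: "'a::real_normed_vector \<Rightarrow> 'b::real_normed_algebra"
  shows "Ck n f \<Longrightarrow> Ck n g \<Longrightarrow> Ck n (\<lambda>x. f x * g x)"
proof (induction n arbitrary: f g)
  case 0
  then show ?case by (auto intro: continuous_intros)
next
  case (Suc n)
  show ?case
    by (rule Ck_cong_deriv[OF has_derivative_mult[OF Ck_SucD(1)[OF Suc.prems(1)] Ck_SucD(1)[OF Suc.prems(2)]]])
       (rule Ck_add; rule Suc.IH; fact Ck_SucD(2,3)[OF Suc.prems(1)] Ck_SucD(2,3)[OF Suc.prems(2)])
qed

lemma Ck_cmult:
  fixes f :: "'a::real_normed_vector \<Rightarrow> 'b::real_normed_algebra"
  shows "Ck n f \<Longrightarrow> Ck n (\<lambda>x. c * f x)"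
  by (intro Ck_mult Ck_const)

lemma Ck_diff:
  fixes f :: "'a::real_normed_vector \<Rightarrow> real"
  assumes "Ck n f" "Ck n g" shows "Ck n (\<lambda>x. f x - g x)"
  using Ck_add[OF assms(1) Ck_cmult[OF assms(2), of "-1"]] by simp

lemma Ck_inverse:
  fixes f :: "'a::real_normed_vector \<Rightarrow> real"
  shows "Ck n f \<Longrightarrow> (\<And>x. f x \<noteq> 0) \<Longrightarrow> Ck n (\<lambda>x. inverse (f x))"
proof (induction n arbitrary: f)
  case 0
  then show ?case by (auto intro: continuous_intros)
next
  case (Suc n)
  show ?case
  proof (rule Ck_cong_deriv[OF Deriv.has_derivative_inverse[OF Suc.prems(2) Ck_SucD(1)[OF Suc.prems(1)]]])
    fix v
    have "Ck n (\<lambda>x. (-1) * (inverse (f x) * frechet_derivative f (at x) v * inverse (f x)))"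
      by (rule Ck_mult[OF Ck_const Ck_mult[OF Ck_mult]];
          (rule Suc.IH[OF Ck_SucD(3)[OF Suc.prems(1)] Suc.prems(2)] Ck_SucD(2)[OF Suc.prems(1)])+)
    then show "Ck n (\<lambda>x. - (inverse (f x) * frechet_derivative f (at x) v * inverse (f x)))"
      by simp
  qed
qed

lemma Ck_scale: "Ck n f \<Longrightarrow> Ck n (\<lambda>x. f (a *\<^sub>R x))"
proof (induction n arbitrary: f)
  case 0
  then have "continuous_on UNIV (f \<circ> (*\<^sub>R) a)"
    by (intro continuous_on_compose continuous_intros) (auto intro: continuous_on_subset)
  then show ?case by (simp add: o_def)
next
  case (Suc n)
  have "((\<lambda>x. f (a *\<^sub>R x)) has_derivative (\<lambda>v. frechet_derivative f (at (a *\<^sub>R x)) (a *\<^sub>R v))) (at x)" for x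
    by (rule has_derivative_compose[of "\<lambda>x. a *\<^sub>R x" "\<lambda>v. a *\<^sub>R v"])
       (auto intro!: derivative_eq_intros Ck_SucD(1)[OF Suc.prems])
  then show ?case
    by (rule Ck_cong_deriv) (rule Suc.IH[OF Ck_SucD(2)[OF Suc.prems]])
qed

section \<open>Iterated differences\<close>

text \<open>The forward difference of \<open>f\<close> with increment \<open>v\<close>.\<close>

definition fdiff :: "'a::ab_group_add \<Rightarrow> ('a \<Rightarrow> 'b::ab_group_add) \<Rightarrow> 'a \<Rightarrow> 'b" where
  "fdiff v f x = f (x + v) - f x"

lemma has_derivative_fdiffs:
  assumes "\<And>x. (f has_derivative f' x) (at x)"
  shows "(foldr fdiff vs f has_derivative (\<lambda>u. foldr fdiff vs (\<lambda>x. f' x u) x)) (at x)"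
proof (induction vs arbitrary: x)
  case Nil
  then show ?case using assms by simp
next
  case (Cons v vs)
  have "((\<lambda>x. foldr fdiff vs f (x + v)) has_derivative (\<lambda>u. foldr fdiff vs (\<lambda>x. f' x u) (x + v))) (at x)"
    by (rule has_derivative_compose[of "\<lambda>x. x + v" "\<lambda>u. u", OF _ Cons])
       (auto intro!: derivative_eq_intros)
  from has_derivative_diff[OF this Cons] show ?case
    by (simp add: fdiff_def[abs_def])
qed

lemma compact_support_bounded:
  fixes f :: "'a::euclidean_space \<Rightarrow> real"
  assumes "continuous_on UNIV f" "\<And>x. norm x > R \<Longrightarrow> f x = 0"
  obtains M where "M \<ge> 0" "\<And>x. \<bar>f x\<bar> \<le> M"
proof -
  have "compact (f ` cball 0 R)"
    by (intro compact_continuous_image continuous_on_subset[OF assms(1)]) auto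
  then have "bounded (f ` cball 0 R)" by (rule compact_imp_bounded)
  then obtain M where M: "\<And>x. norm x \<le> R \<Longrightarrow> \<bar>f x\<bar> \<le> M"
    unfolding bounded_iff by fastforce
  show thesis
  proof (rule that[of "max M 0"])
    show "\<bar>f x\<bar> \<le> max M 0" for x
      using M[of x] assms(2)[of x] by (cases "norm x \<le> R") auto
  qed simp
qed

text \<open>A mixed difference with \<open>n\<close> increments proportional to \<open>h\<close> is \<open>O(h\<^sup>n)\<close>, because differences commute
  with differentiation and the mean value theorem applies to one increment after the other.\<close>

lemma fdiffs_bound:
  fixes f :: "'a::euclidean_space \<Rightarrow> real"
  assumes "Ck n f" "\<And>x. norm x > R \<Longrightarrow> f x = 0" "length vs \<le> n"
  shows "\<exists>M\<ge>0. \<forall>h\<ge>0. \<forall>x. \<bar>foldr fdiff (map (\<lambda>v. h *\<^sub>R v) vs) f x\<bar> \<le> M * h ^ length vs"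
  using assms
proof (induction vs arbitrary: n f)
  case Nil
  have "Ck 0 f" using Nil(1) by (induction n) (blast dest: Ck_mono_Suc)+
  then obtain M where "M \<ge> 0" "\<And>x. \<bar>f x\<bar> \<le> M"
    using compact_support_bounded[of f R] Nil(2) by (metis Ck.simps(1))
  then show ?case by auto
next
  case (Cons v vs)
  obtain m where n: "n = Suc m" using Cons.prems(3) by (cases n) auto
  note ck = Cons.prems(1)[unfolded n]
  define f' where "f' x = frechet_derivative f (at x)" for x
  have f': "(f has_derivative f' x) (at x)" for x
    unfolding f'_def by (rule Ck_SucD(1)[OF ck])
  have zero: "f' x v = 0" if "norm x > R" for x
  proof -
    have "open {x. norm x > R}" by (intro open_Collect_less continuous_intros)
    moreover have "((\<lambda>x. 0::real) has_derivative (\<lambda>u. 0)) (at x)" by simp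
    ultimately have "(f has_derivative (\<lambda>u. 0)) (at x)"
      using has_derivative_transform_within_open[of "\<lambda>x. 0::real" "\<lambda>u. 0" x UNIV _ f] that Cons.prems(2) by auto
    then show ?thesis using has_derivative_unique[OF f'] by metis
  qed
  obtain M where M: "M \<ge> 0"
    "\<And>h x. h \<ge> 0 \<Longrightarrow> \<bar>foldr fdiff (map (\<lambda>v. h *\<^sub>R v) vs) (\<lambda>x. f' x v) x\<bar> \<le> M * h ^ length vs"
    using Cons.IH[of m "\<lambda>x. f' x v"] Ck_SucD(2)[OF ck] zero Cons.prems(3) n
    unfolding f'_def by fastforce
  have "\<bar>foldr fdiff (map (\<lambda>v. h *\<^sub>R v) (v # vs)) f x\<bar> \<le> M * h ^ length (v # vs)" if h: "h \<ge> 0" for h x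
  proof -
    define F where "F = foldr fdiff (map (\<lambda>v. h *\<^sub>R v) vs) f"
    define F' where "F' = foldr fdiff (map (\<lambda>v. h *\<^sub>R v) vs) (\<lambda>x. f' x v)"
    have dF: "(F has_derivative (\<lambda>u. foldr fdiff (map (\<lambda>v. h *\<^sub>R v) vs) (\<lambda>x. f' x u) x)) (at x)" for x
      unfolding F_def by (rule has_derivative_fdiffs[OF f'])
    have "((\<lambda>t. F (x + t *\<^sub>R v)) has_field_derivative F' (x + t *\<^sub>R v)) (at t)" for t
    proof -
      have "((\<lambda>t. F (x + t *\<^sub>R v)) has_derivative
         (\<lambda>s. foldr fdiff (map (\<lambda>v. h *\<^sub>R v) vs) (\<lambda>x. f' x (s *\<^sub>R v)) (x + t *\<^sub>R v))) (at t)"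
        by (rule has_derivative_compose[of "\<lambda>t. x + t *\<^sub>R v" "\<lambda>s. s *\<^sub>R v", OF _ dF])
           (auto intro!: derivative_eq_intros)
      moreover have "foldr fdiff (map (\<lambda>v. h *\<^sub>R v) vs) (\<lambda>x. f' x (s *\<^sub>R v)) y = F' y * s" for s y
        using linear_scale[OF has_derivative_linear[OF dF[of y]], of s v] unfolding F'_def by simp
      ultimately show ?thesis by (simp add: has_field_derivative_def)
    qed
    \<comment> \<open>mean value theorem along the segment from \<open>x\<close> to \<open>x + h v\<close>\<close>
    then have "\<bar>F (x + h *\<^sub>R v) - F (x + 0 *\<^sub>R v)\<bar> \<le> (M * h ^ length vs) * \<bar>h - 0\<bar>"
      using field_differentiable_bound[of UNIV "\<lambda>t. F (x + t *\<^sub>R v)" "\<lambda>t. F' (x + t *\<^sub>R v)" "M * h ^ length vs" h 0]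
        M(2)[OF h] unfolding F'_def by auto
    then show ?thesis using h by (simp add: fdiff_def F_def mult_ac)
  qed
  with M(1) show ?case by blast
qed

section \<open>Summation by parts over lattice boxes\<close>

lemma atLeastAtMost_int_Suc: "{a..a + int (Suc n)} = insert (a + int n + 1) {a..a + int n}"
  by auto

lemma summation_by_parts:
  fixes m w :: "int \<Rightarrow> complex"
  shows "(\<Sum>k\<in>{a..a + int n}. m k * w k) = m (a + int n) * (\<Sum>k\<in>{a..a + int n}. w k)
    - (\<Sum>i<n. (m (a + int i + 1) - m (a + int i)) * (\<Sum>k\<in>{a..a + int i}. w k))"
proof (induction n)
  case (Suc n)
  then show ?case unfolding atLeastAtMost_int_Suc by (simp add: algebra_simps)
qed simp

text \<open>A multiplier of size \<open>M\<close> that varies by at most \<open>M / L\<close> from one integer to the next has total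
  variation at most \<open>M\<close> over an interval of length \<open>L\<close>.\<close>

lemma summation_by_parts_bound:
  fixes m w :: "int \<Rightarrow> complex"
  assumes "L > 0" "real_of_int (b - a) \<le> L" "M \<ge> 0"
    and K: "\<And>b'. b' \<le> b \<Longrightarrow> norm (\<Sum>k\<in>{a..b'}. w k) \<le> K"
    and m: "\<And>k. norm (m k) \<le> M" "\<And>k. norm (m (k + 1) - m k) \<le> M / L"
  shows "norm (\<Sum>k\<in>{a..b}. m k * w k) \<le> 2 * K * M"
proof (cases "a \<le> b")
  case True
  define n where "n = nat (b - a)"
  have b: "b = a + int n" using True by (simp add: n_def)
  have "K \<ge> 0" using K[of b] by (meson norm_ge_zero order_trans order_refl)
  have "norm (\<Sum>k\<in>{a..b}. m k * w k) \<le> norm (m (a + int n) * (\<Sum>k\<in>{a..a + int n}. w k))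
     + norm (\<Sum>i<n. (m (a + int i + 1) - m (a + int i)) * (\<Sum>k\<in>{a..a + int i}. w k))"
    unfolding b summation_by_parts by (rule norm_triangle_ineq4)
  also have "\<dots> \<le> M * K + (\<Sum>i<n. M / L * K)"
  proof (intro add_mono order_trans[OF norm_sum] sum_mono)
    show "norm (m (a + int n) * (\<Sum>k\<in>{a..a + int n}. w k)) \<le> M * K"
      unfolding norm_mult by (intro mult_mono m K) (use \<open>M \<ge> 0\<close> b in auto)
    show "norm ((m (a + int i + 1) - m (a + int i)) * (\<Sum>k\<in>{a..a + int i}. w k)) \<le> M / L * K"
      if "i \<in> {..<n}" for i
      unfolding norm_mult by (intro mult_mono m K) (use \<open>M \<ge> 0\<close> \<open>L > 0\<close> b that in auto)
  qed
  also have "\<dots> = M * K * (1 + real n / L)" by (simp add: field_simps)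
  also have "\<dots> \<le> M * K * (1 + 1)"
    using assms(1,2,3) \<open>K \<ge> 0\<close> b by (intro mult_left_mono add_mono) auto
  finally show ?thesis by (simp add: mult_ac)
next
  case False
  then show ?thesis using K[of b] \<open>M \<ge> 0\<close> by simp
qed

text \<open>In two and three dimensions the one-dimensional bound applies to the outermost sum. The
  multiplier is then the inner sum, whose size and differences are bounded by the previous case.\<close>

lemma summation_by_parts_bound_2:
  fixes m :: "int \<Rightarrow> int \<Rightarrow> complex"
  assumes L: "L > 0" "real_of_int (b1 - a1) \<le> L" "real_of_int (b2 - a2) \<le> L" and "M \<ge> 0"
    and K1: "\<And>b'. b' \<le> b1 \<Longrightarrow> norm (\<Sum>k\<in>{a1..b'}. w1 k) \<le> K1"
    and K2: "\<And>b'. b' \<le> b2 \<Longrightarrow> norm (\<Sum>k\<in>{a2..b'}. w2 k) \<le> K2"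
    and m: "\<And>i j. norm (m i j) \<le> M"
      "\<And>i j. norm (m (i + 1) j - m i j) \<le> M / L"
      "\<And>i j. norm (m i (j + 1) - m i j) \<le> M / L"
      "\<And>i j. norm ((m (i + 1) (j + 1) - m i (j + 1)) - (m (i + 1) j - m i j)) \<le> M / L\<^sup>2"
  shows "norm (\<Sum>i\<in>{a1..b1}. (\<Sum>j\<in>{a2..b2}. m i j * w2 j) * w1 i) \<le> 4 * K1 * K2 * M"
proof -
  have "K2 \<ge> 0" using K2[of b2] by (meson norm_ge_zero order_trans order_refl)
  have 1: "norm (\<Sum>j\<in>{a2..b2}. m i j * w2 j) \<le> 2 * K2 * M" for i
    by (rule summation_by_parts_bound[where m = "m i", OF L(1,3) \<open>M \<ge> 0\<close> K2 m(1,3)])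
  have 2: "norm ((\<Sum>j\<in>{a2..b2}. m (i + 1) j * w2 j) - (\<Sum>j\<in>{a2..b2}. m i j * w2 j)) \<le> 2 * K2 * M / L" for i
  proof -
    have "norm (\<Sum>j\<in>{a2..b2}. (m (i + 1) j - m i j) * w2 j) \<le> 2 * K2 * (M / L)"
      by (rule summation_by_parts_bound[OF L(1,3) _ K2])
         (use m L \<open>M \<ge> 0\<close> in \<open>auto simp: power2_eq_square\<close>)
    then show ?thesis by (simp add: sum_subtractf left_diff_distrib)
  qed
  have "norm (\<Sum>i\<in>{a1..b1}. (\<Sum>j\<in>{a2..b2}. m i j * w2 j) * w1 i) \<le> 2 * K1 * (2 * K2 * M)"
    by (rule summation_by_parts_bound[where m = "\<lambda>i. \<Sum>j\<in>{a2..b2}. m i j * w2 j", OF L(1,2) _ K1 1 2]) (use \<open>K2 \<ge> 0\<close> \<open>M \<ge> 0\<close> in auto)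
  then show ?thesis by (simp add: mult_ac)
qed

lemma summation_by_parts_bound_3:
  fixes m :: "int \<Rightarrow> int \<Rightarrow> int \<Rightarrow> complex"
  assumes L: "L > 0" "real_of_int (b1 - a1) \<le> L" "real_of_int (b2 - a2) \<le> L"
      "real_of_int (b3 - a3) \<le> L" and "M \<ge> 0"
    and K1: "\<And>b'. b' \<le> b1 \<Longrightarrow> norm (\<Sum>k\<in>{a1..b'}. w1 k) \<le> K1"
    and K2: "\<And>b'. b' \<le> b2 \<Longrightarrow> norm (\<Sum>k\<in>{a2..b'}. w2 k) \<le> K2"
    and K3: "\<And>b'. b' \<le> b3 \<Longrightarrow> norm (\<Sum>k\<in>{a3..b'}. w3 k) \<le> K3"
    and m: "\<And>i j k. norm (m i j k) \<le> M"
      "\<And>i j k. norm (m (i + 1) j k - m i j k) \<le> M / L"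
      "\<And>i j k. norm (m i (j + 1) k - m i j k) \<le> M / L"
      "\<And>i j k. norm (m i j (k + 1) - m i j k) \<le> M / L"
      "\<And>i j k. norm ((m (i + 1) (j + 1) k - m i (j + 1) k) - (m (i + 1) j k - m i j k)) \<le> M / L\<^sup>2"
      "\<And>i j k. norm ((m (i + 1) j (k + 1) - m i j (k + 1)) - (m (i + 1) j k - m i j k)) \<le> M / L\<^sup>2"
      "\<And>i j k. norm ((m i (j + 1) (k + 1) - m i j (k + 1)) - (m i (j + 1) k - m i j k)) \<le> M / L\<^sup>2"
      "\<And>i j k. norm (((m (i + 1) (j + 1) (k + 1) - m i (j + 1) (k + 1)) - (m (i + 1) j (k + 1) - m i j (k + 1)))
         - ((m (i + 1) (j + 1) k - m i (j + 1) k) - (m (i + 1) j k - m i j k))) \<le> M / L ^ 3"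
  shows "norm (\<Sum>i\<in>{a1..b1}. (\<Sum>j\<in>{a2..b2}. (\<Sum>k\<in>{a3..b3}. m i j k * w3 k) * w2 j) * w1 i)
    \<le> 8 * K1 * K2 * K3 * M"
proof -
  have "K3 \<ge> 0" using K3[of b3] by (meson norm_ge_zero order_trans order_refl)
  define T where "T i j = (\<Sum>k\<in>{a3..b3}. m i j k * w3 k)" for i j
  have T: "norm (T i j) \<le> 2 * K3 * M" for i j
    unfolding T_def by (rule summation_by_parts_bound[where m = "m i j", OF L(1,4) \<open>M \<ge> 0\<close> K3 m(1,4)])
  have T1: "norm (T (i + 1) j - T i j) \<le> 2 * K3 * M / L" for i j
  proof -
    have "norm (\<Sum>k\<in>{a3..b3}. (m (i + 1) j k - m i j k) * w3 k) \<le> 2 * K3 * (M / L)"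
      by (rule summation_by_parts_bound[OF L(1,4) _ K3])
         (use m L \<open>M \<ge> 0\<close> in \<open>auto simp: power2_eq_square\<close>)
    then show ?thesis by (simp add: T_def sum_subtractf left_diff_distrib)
  qed
  have T2: "norm (T i (j + 1) - T i j) \<le> 2 * K3 * M / L" for i j
  proof -
    have "norm (\<Sum>k\<in>{a3..b3}. (m i (j + 1) k - m i j k) * w3 k) \<le> 2 * K3 * (M / L)"
      by (rule summation_by_parts_bound[OF L(1,4) _ K3])
         (use m L \<open>M \<ge> 0\<close> in \<open>auto simp: power2_eq_square\<close>)
    then show ?thesis by (simp add: T_def sum_subtractf left_diff_distrib)
  qed
  have T12: "norm ((T (i + 1) (j + 1) - T i (j + 1)) - (T (i + 1) j - T i j)) \<le> 2 * K3 * M / L\<^sup>2" for i j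
  proof -
    have "norm (\<Sum>k\<in>{a3..b3}. ((m (i + 1) (j + 1) k - m i (j + 1) k) - (m (i + 1) j k - m i j k)) * w3 k)
        \<le> 2 * K3 * (M / L\<^sup>2)"
      by (rule summation_by_parts_bound[OF L(1,4) _ K3])
         (use m L \<open>M \<ge> 0\<close> in \<open>auto simp: power2_eq_square power3_eq_cube\<close>)
    then show ?thesis by (simp add: T_def sum_subtractf left_diff_distrib)
  qed
  have "norm (\<Sum>i\<in>{a1..b1}. (\<Sum>j\<in>{a2..b2}. T i j * w2 j) * w1 i) \<le> 4 * K1 * K2 * (2 * K3 * M)"
    by (rule summation_by_parts_bound_2[where m = T, OF L(1,2,3) _ K1 K2 T T1 T2 T12])
       (use \<open>K3 \<ge> 0\<close> \<open>M \<ge> 0\<close> in auto)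
  then show ?thesis by (simp add: T_def mult_ac)
qed

section \<open>The Dirichlet kernel\<close>

lemma half_le_sin:
  assumes "0 \<le> y" "y \<le> pi / 2" shows "y / 2 \<le> sin y"
proof (cases "y = 0")
  case False
  then obtain z where z: "0 < z" "z < y / 2" "sin (y / 2) - sin 0 = (y / 2 - 0) * cos z"
    using MVT2[of 0 "y / 2" sin cos] assms by (auto intro: DERIV_sin)
  have "cos (pi / 4) \<le> cos z" "cos (pi / 4) \<le> cos (y / 2)"
    using z assms by (auto intro!: cos_monotone_0_pi_le)
  then have c: "sqrt 2 / 2 \<le> cos z" "sqrt 2 / 2 \<le> cos (y / 2)" by (auto simp: cos_45)
  \<comment> \<open>double angle formula: \<open>sin y = 2 sin (y / 2) cos (y / 2)\<close>, with \<open>sin (y / 2) = (y / 2) cos z\<close>\<close>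
  have "(sqrt 2 / 2) * (sqrt 2 / 2) \<le> cos z * cos (y / 2)"
    by (rule mult_mono) (use c in \<open>auto intro: order_trans[OF _ c(1)]\<close>)
  then have "y * (1 / 2) \<le> y * (cos z * cos (y / 2))"
    using assms(1) by (intro mult_left_mono) auto
  also have "\<dots> = 2 * sin (y / 2) * cos (y / 2)" using z(3) by simp
  also have "\<dots> = sin y" using sin_double[of "y / 2"] by simp
  finally show ?thesis by simp
qed simp

lemma norm_one_minus_cis: "norm (1 - cis t) = 2 * \<bar>sin (t / 2)\<bar>"
proof -
  have "(norm (1 - cis t))\<^sup>2 = 2 - 2 * cos t"
    unfolding cmod_power2 by (simp add: power2_diff cis.sel)
  also have "cos t = 1 - 2 * (sin (t / 2))\<^sup>2" using cos_double_sin[of "t / 2"] by simp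
  finally have "(norm (1 - cis t))\<^sup>2 = (2 * \<bar>sin (t / 2)\<bar>)\<^sup>2" by (simp add: power_mult_distrib)
  then show ?thesis by (metis abs_ge_zero mult_nonneg_nonneg norm_ge_zero power2_eq_imp_eq zero_le_numeral)
qed

text \<open>A majorant on \<open>[0, 2\<pi>]\<close>, up to a constant factor, for Dirichlet kernels of length \<open>L\<close>. It has
  peaks of height about \<open>L\<close> and width about \<open>1 / L\<close> at the two endpoints, which represent the same
  point of the circle.\<close>

definition peak :: "real \<Rightarrow> real \<Rightarrow> real" where
  "peak L t = 1 / (1 / L + t) + 1 / (1 / L + (2 * pi - t))"

lemma geometric_sum_cis:
  "(1 - cis t) * (\<Sum>k\<in>{a..a + int n}. cis (of_int k * t)) = cis (of_int a * t) - cis (of_int (a + int n + 1) * t)"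
proof (induction n)
  case 0
  then show ?case by (simp add: algebra_simps cis_mult)
next
  case (Suc n)
  then show ?case unfolding atLeastAtMost_int_Suc
    by (simp add: distrib_left) (simp add: algebra_simps cis_mult)
qed

text \<open>With \<open>s\<close> the distance from \<open>t\<close> to the nearest endpoint, the kernel is at most \<open>3 L\<close> by counting terms
  and at most \<open>4 / s\<close> by summing the geometric series. The lower bound on \<open>L\<close> bounds the number of
  terms, at most \<open>L + 1\<close>, by \<open>3 L\<close>.\<close>

lemma dirichlet_kernel_bound:
  assumes L: "L \<ge> 1 / 2" "real_of_int (b - a) \<le> L" and t: "0 \<le> t" "t \<le> 2 * pi"
  shows "norm (\<Sum>k\<in>{a..b}. cis (of_int k * t)) \<le> 7 * peak L t"
proof -
  define D where "D = norm (\<Sum>k\<in>{a..b}. cis (of_int k * t))"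
  define s where "s = min t (2 * pi - t)"
  have s: "0 \<le> s" "s \<le> pi" using t by (auto simp: s_def)
  have D1: "D \<le> 3 * L"
  proof -
    have "D \<le> (\<Sum>k\<in>{a..b}. 1)" unfolding D_def by (rule order_trans[OF norm_sum]) simp
    also have "\<dots> \<le> 3 * L" using L by (cases "a \<le> b + 1") (auto simp: of_nat_nat)
    finally show ?thesis .
  qed
  have D2: "s * D \<le> 4"
  proof (cases "a \<le> b")
    case True
    define n where "n = nat (b - a)"
    have b: "b = a + int n" using True by (simp add: n_def)
    have "norm (1 - cis t) * D \<le> 2"
      unfolding D_def norm_mult[symmetric] b geometric_sum_cis
      by (rule order_trans[OF norm_triangle_ineq4]) simp
    moreover have "sin (s / 2) = sin (t / 2)"
    proof (cases "t \<le> 2 * pi - t")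
      case False
      then have "s / 2 = pi - t / 2" by (simp add: s_def field_simps)
      then show ?thesis by (simp only: sin_pi_minus)
    qed (simp add: s_def)
    moreover have "s / 2 / 2 \<le> sin (s / 2)" using s by (intro half_le_sin) auto
    ultimately have "2 * sin (s / 2) * D \<le> 2" "s / 4 \<le> sin (s / 2)" "0 \<le> sin (s / 2)"
      using s by (auto simp: norm_one_minus_cis)
    moreover have "s / 4 * D \<le> sin (s / 2) * D"
      using \<open>s / 4 \<le> sin (s / 2)\<close> by (intro mult_right_mono) (auto simp: D_def)
    ultimately show ?thesis by simp
  qed (simp add: D_def)
  have pos: "1 / L + s > 0" using L s by (intro add_pos_nonneg) auto
  have "D / L \<le> 3" using D1 L by (simp add: field_simps)
  then have "D * (1 / L + s) \<le> 7" using D2 by (simp add: distrib_left mult.commute)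
  then have "D \<le> 7 * (1 / (1 / L + s))" using pos by (simp add: pos_le_divide_eq)
  also have "1 / (1 / L + s) \<le> peak L t"
    using L t by (auto simp: s_def min_def peak_def)
  finally show ?thesis by (simp add: D_def)
qed

lemma peak_nonneg: "L > 0 \<Longrightarrow> 0 \<le> t \<Longrightarrow> t \<le> 2 * pi \<Longrightarrow> 0 \<le> peak L t"
  by (simp add: peak_def)

lemma peak_le:
  assumes "L > 0" "0 \<le> t" "t \<le> 2 * pi" shows "peak L t \<le> 2 * L"
proof -
  have "1 / (1 / L + s) \<le> L" if "s \<ge> 0" for s
  proof -
    have "1 / (1 / L + s) \<le> 1 / (1 / L)" using assms that by (intro divide_left_mono) (auto intro!: mult_pos_pos divide_pos_pos add_pos_nonneg)
    then show ?thesis by simp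
  qed
  from this[of t] this[of "2 * pi - t"] show ?thesis using assms by (simp add: peak_def)
qed

lemma powr_add_le:
  fixes a b r :: real
  assumes "a \<ge> 0" "b \<ge> 0" "r \<ge> 0"
  shows "(a + b) powr r \<le> 2 powr r * (a powr r + b powr r)"
proof -
  have "(a + b) powr r \<le> (2 * max a b) powr r" using assms by (intro powr_mono2) auto
  also have "\<dots> = 2 powr r * max a b powr r" using assms by (simp add: powr_mult)
  also have "\<dots> \<le> 2 powr r * (a powr r + b powr r)" by (intro mult_left_mono) (auto simp: max_def)
  finally show ?thesis .
qed

text \<open>This is where \<open>r > 1\<close> is needed: for \<open>r = 1\<close> the integral grows like \<open>ln L\<close>.\<close>

lemma nn_integral_peak_powr:
  assumes L: "L > 0" and r: "r > 1"
  shows "(\<integral>\<^sup>+ t. ennreal (peak L t powr r) * indicator {0..2 * pi} t \<partial>lborel)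
    \<le> ennreal (2 powr r * 2 / (r - 1) * L powr (r - 1))"
proof -
  define h where "h = 1 / L"
  have h: "h > 0" using L by (simp add: h_def)
  define f where "f t = 2 powr r * ((1 / (h + t)) powr r + (1 / (h + (2 * pi - t))) powr r)" for t
  \<comment> \<open>\<open>F\<close> is an antiderivative of \<open>f\<close>, which dominates the integrand\<close>
  define F where "F t = 2 powr r / (r - 1) * ((h + (2 * pi - t)) powr (1 - r) - (h + t) powr (1 - r))" for t
  have meas: "f \<in> borel_measurable borel" unfolding f_def[abs_def] by measurable
  have "(\<integral>\<^sup>+ t. ennreal (peak L t powr r) * indicator {0..2 * pi} t \<partial>lborel)
    \<le> (\<integral>\<^sup>+ t. ennreal (f t) * indicator {0..2 * pi} t \<partial>lborel)"
  proof (rule nn_integral_mono)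
    fix t :: real
    show "ennreal (peak L t powr r) * indicator {0..2 * pi} t \<le> ennreal (f t) * indicator {0..2 * pi} t"
      using powr_add_le[of "1 / (1 / L + t)" "1 / (1 / L + (2 * pi - t))" r] L r
      by (auto simp: indicator_def peak_def f_def h_def intro!: ennreal_leI)
  qed
  also have "\<dots> = ennreal (F (2 * pi) - F 0)"
  proof (rule nn_integral_FTC_Icc[OF meas])
    fix t :: real assume "t \<in> {0..2 * pi}"
    then have t: "0 \<le> t" "t \<le> 2 * pi" by auto
    show "0 \<le> f t" by (simp add: f_def)
    have p: "h + t > 0" "h + (2 * pi - t) > 0" using h t by auto
    have d1: "((\<lambda>t. (h + (2 * pi - t)) powr (1 - r)) has_real_derivative
        (1 - r) * (h + (2 * pi - t)) powr (1 - r - 1) * (-1)) (at t)"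
    proof -
      have "((\<lambda>t. h + (2 * pi - t)) has_real_derivative -1) (at t)"
        by (auto intro!: derivative_eq_intros)
      from DERIV_fun_powr[OF this p(2), of "1 - r"] show ?thesis by simp
    qed
    have d2: "((\<lambda>t. (h + t) powr (1 - r)) has_real_derivative
        (1 - r) * (h + t) powr (1 - r - 1) * 1) (at t)"
    proof -
      have "((\<lambda>t. h + t) has_real_derivative 1) (at t)"
        by (auto intro!: derivative_eq_intros)
      from DERIV_fun_powr[OF this p(1), of "1 - r"] show ?thesis by simp
    qed
    have "(F has_real_derivative 2 powr r / (r - 1) *
       ((1 - r) * (h + (2 * pi - t)) powr (1 - r - 1) * (-1) - (1 - r) * (h + t) powr (1 - r - 1))) (at t)"
      unfolding F_def[abs_def] using DERIV_cmult[OF DERIV_diff[OF d1 d2], of "2 powr r / (r - 1)"] by (simp only: mult_1_right)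
    also have "2 powr r / (r - 1) *
       ((1 - r) * (h + (2 * pi - t)) powr (1 - r - 1) * (-1) - (1 - r) * (h + t) powr (1 - r - 1))
      = 2 powr r * ((h + (2 * pi - t)) powr (- r) + (h + t) powr (- r))"
    proof -
      have "a / (r - 1) * ((1 - r) * X * (-1) - (1 - r) * Y) = a * (X + Y)" for a X Y :: real
        using r by (simp add: divide_simps) (simp add: algebra_simps)
      then show ?thesis by simp
    qed
    also have "\<dots> = f t" using p unfolding f_def by (simp add: powr_divide powr_minus_divide)
    finally show "DERIV F t :> f t" .
  qed simp
  also have "F (2 * pi) - F 0 = 2 powr r * 2 / (r - 1) * (h powr (1 - r) - (h + 2 * pi) powr (1 - r))"
  proof -
    have "a / b * (X - Y) - a / b * (Y - X) = a * 2 / b * (X - Y)" for a b X Y :: real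
      by (cases "b = 0") (simp_all add: field_simps)
    then show ?thesis by (simp add: F_def)
  qed
  also have "\<dots> \<le> 2 powr r * 2 / (r - 1) * (h powr (1 - r))"
    using r by (intro mult_left_mono) auto
  also have "h powr (1 - r) = L powr (r - 1)"
    using L by (simp add: h_def powr_divide powr_minus_divide[symmetric] minus_diff_eq)
  finally show ?thesis by (simp add: ennreal_leI)
qed

section \<open>Integration over the torus\<close>

lemma Basis_cart_real: "(Basis :: (real^'n::finite) set) = (\<lambda>i. axis i 1) ` UNIV"
  by (auto simp: Basis_vec_def)

lemma prod_Basis_cart:
  "(\<Prod>b\<in>(Basis :: (real^'n::finite) set). f b) = (\<Prod>i\<in>UNIV. f (axis i 1))"
  unfolding Basis_cart_real by (subst prod.reindex) (auto simp: inj_on_def axis_eq_axis)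

lemma indicator_cbox_cart:
  fixes a b x :: "real^'n::finite"
  shows "indicator (cbox a b) x = (\<Prod>i\<in>UNIV. indicator {a $ i..b $ i} (x $ i) :: 'a::comm_semiring_1)"
proof (cases "x \<in> cbox a b")
  case True
  then have "indicator {a $ i..b $ i} (x $ i) = (1 :: 'a)" for i by (simp add: mem_box_cart)
  then show ?thesis using True by simp
next
  case False
  then obtain i where "x $ i \<notin> {a $ i..b $ i}" by (auto simp: mem_box_cart)
  then have "(\<Prod>i\<in>UNIV. indicator {a $ i..b $ i} (x $ i) :: 'a) = 0"
    by (intro prod_zero bexI[of _ i]) auto
  then show ?thesis using False by simp
qed

lemma nn_integral_torus:
  "(\<integral>\<^sup>+ x. f x \<partial>torus) = (\<integral>\<^sup>+ x. f x * indicator (cbox 0 (\<chi> i. 2 * pi)) x \<partial>lborel)"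
  unfolding torus_def
  by (subst nn_integral_restrict_space) (auto simp: nn_integral_completion)

lemma nn_integral_torus_prod:
  fixes f :: "real \<Rightarrow> ennreal"
  assumes [measurable]: "f \<in> borel_measurable borel"
  shows "(\<integral>\<^sup>+ x. a * (\<Prod>i\<in>UNIV. f (x $ i)) \<partial>torus) = a * (\<integral>\<^sup>+ t. f t * indicator {0..2 * pi} t \<partial>lborel) ^ 3"
proof -
  define g where "g t = f t * indicator {0..2 * pi} t" for t
  have [measurable]: "g \<in> borel_measurable borel" unfolding g_def[abs_def] by measurable
  have "(\<integral>\<^sup>+ x. a * (\<Prod>i\<in>UNIV. f (x $ i)) \<partial>torus)
    = (\<integral>\<^sup>+ x. a * (\<Prod>b\<in>Basis. g (x \<bullet> b)) \<partial>(lborel :: (real^3) measure))"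
    unfolding nn_integral_torus
    by (simp add: prod_Basis_cart indicator_cbox_cart g_def prod.distrib inner_axis mult.assoc)
  also have "\<dots> = a * (\<integral>\<^sup>+ x. (\<Prod>b\<in>Basis. g (x \<bullet> b)) \<partial>(lborel :: (real^3) measure))"
    by (rule nn_integral_cmult) measurable
  also have "(\<integral>\<^sup>+ x. (\<Prod>b\<in>Basis. g (x \<bullet> b)) \<partial>(lborel :: (real^3) measure))
    = (\<Prod>b\<in>(Basis :: (real^3) set). (\<integral>\<^sup>+ t. g t \<partial>lborel))"
    by (rule nn_integral_lborel_prod) auto
  finally show ?thesis by (simp add: g_def)
qed

lemma integral_torus_prod:
  fixes g :: "3 \<Rightarrow> real \<Rightarrow> complex"
  assumes cont: "\<And>i. continuous_on UNIV (g i)"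
  shows "(LINT x|torus. (\<Prod>i\<in>UNIV. g i (x $ i))) = (\<Prod>i\<in>UNIV. (LINT t|lborel. indicator {0..2 * pi} t *\<^sub>R g i t))"
proof -
  \<comment> \<open>\<open>g\<close> re-indexed by the unit vectors and cut off; the product has one factor, as \<open>axis\<close> is injective\<close>
  define h where "h b t = indicator {0..2 * pi} t *\<^sub>R (\<Prod>i\<in>{i. axis i 1 = b}. g i t)" for b :: "real^3" and t :: real
  have h_axis: "h (axis i 1) t = indicator {0..2 * pi} t *\<^sub>R g i t" for i t
  proof -
    have "{i'. axis i' (1::real) = axis i 1} = {i}" by (auto simp: axis_eq_axis)
    then show ?thesis by (simp add: h_def)
  qed
  have [measurable]: "g i \<in> borel_measurable borel" for i
    using cont by (rule borel_measurable_continuous_onI)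
  interpret product_sigma_finite "\<lambda>_::real^3. lborel :: real measure" ..
  have int: "integrable lborel (h b)" if b: "b \<in> Basis" for b
  proof -
    obtain i where b: "b = axis i 1" using b unfolding Basis_cart_real by auto
    have "set_integrable lborel {0..2 * pi} (g i)"
      by (rule borel_integrable_atLeastAtMost') (rule continuous_on_subset[OF cont], simp)
    then show ?thesis by (simp add: set_integrable_def b h_axis[abs_def] cong: integrable_cong)
  qed
  have "(LINT x|torus. (\<Prod>i\<in>UNIV. g i (x $ i)))
    = (LINT x|lebesgue. indicator (cbox 0 (\<chi> i. 2 * pi)) x *\<^sub>R (\<Prod>i\<in>UNIV. g i (x $ i)))"
    unfolding torus_def by (rule integral_restrict_space) simp
  also have "\<dots> = (LINT x|lborel. indicator (cbox 0 (\<chi> i. 2 * pi)) x *\<^sub>R (\<Prod>i\<in>UNIV. g i (x $ i)))"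
    by (rule integral_completion) measurable
  also have "\<dots> = (LINT x|lborel. (\<Prod>b\<in>(Basis::(real^3) set). h b (x \<bullet> b)))"
    by (simp add: prod_Basis_cart h_axis indicator_cbox_cart inner_axis scaleR_conv_of_real prod.distrib)
  also have "\<dots> = (LINT y|(\<Pi>\<^sub>M b\<in>(Basis::(real^3) set). lborel). (\<Prod>b\<in>(Basis::(real^3) set). h b ((\<Sum>b\<in>Basis. y b *\<^sub>R b) \<bullet> b)))"
    unfolding lborel_eq[where 'a = "real^3"] by (rule integral_distr) (auto simp: h_def)
  also have "\<dots> = (LINT y|(\<Pi>\<^sub>M b\<in>(Basis::(real^3) set). lborel). (\<Prod>b\<in>(Basis::(real^3) set). h b (y b)))"
    by (intro Bochner_Integration.integral_cong refl prod.cong)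
       (simp add: inner_sum_left inner_Basis if_distrib cong: if_cong)
  also have "\<dots> = (\<Prod>b\<in>(Basis::(real^3) set). (LINT t|lborel. h b t))"
    by (rule product_integral_prod) (auto intro: int)
  finally show ?thesis by (simp add: prod_Basis_cart h_axis[abs_def])
qed

lemma integral_cis_period:
  "(LINT t|lborel. indicator {0..2 * pi} t *\<^sub>R cis (of_int n * t)) = (if n = 0 then 2 * pi else 0)"
proof (cases "n = 0")
  case True
  then show ?thesis by (simp add: scaleR_conv_of_real)
next
  case False
  have "(LINT t|lborel. indicator {0..2 * pi} t *\<^sub>R cis (of_int n * t))
     = cis (of_int n * (2 * pi)) / (\<i> * of_int n) - cis (of_int n * 0) / (\<i> * of_int n)"
  proof (rule integral_FTC_Icc)
    fix t :: real
    show "((\<lambda>t. cis (of_int n * t) / (\<i> * of_int n)) has_vector_derivative cis (of_int n * t)) (at t within {0..2 * pi})"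
    proof -
      have "((\<lambda>z. exp (\<i> * of_int n * z) / (\<i> * of_int n)) has_field_derivative exp (\<i> * of_int n * of_real t))
          (at (of_real t))"
        using False by (auto intro!: derivative_eq_intros)
      from has_vector_derivative_real_field[OF this] show ?thesis
        by (simp add: cis_conv_exp mult.assoc)
    qed
  qed (auto intro!: continuous_intros)
  also have "cis (of_int n * (2 * pi)) = 1" using cis_multiple_2pi[of "of_int n"] by (simp add: mult_ac)
  finally show ?thesis using False by simp
qed

lemma cis_sum: "finite A \<Longrightarrow> cis (\<Sum>i\<in>A. f i) = (\<Prod>i\<in>A. cis (f i))"
  by (induction A rule: finite_induct) (simp_all flip: cis_mult)

lemma integral_torus_cis:
  "(LINT x|torus. cis (of_lattice k \<bullet> x)) = (if k = 0 then of_real ((2 * pi) ^ 3) else 0)"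
proof -
  have "(LINT x|torus. cis (of_lattice k \<bullet> x)) = (LINT x|torus. (\<Prod>i\<in>UNIV. cis (of_int (k $ i) * x $ i)))"
    by (simp add: inner_vec_def of_lattice_def cis_sum)
  also have "\<dots> = (\<Prod>i\<in>UNIV. (if k $ i = 0 then 2 * pi else 0))"
    by (subst integral_torus_prod) (auto intro!: continuous_intros simp: integral_cis_period)
  also have "\<dots> = (if k = 0 then of_real ((2 * pi) ^ 3) else 0)"
    by (auto simp: vec_eq_iff)
  finally show ?thesis .
qed

lemma integrable_torus:
  fixes f :: "real^3 \<Rightarrow> 'b::euclidean_space"
  shows "continuous_on UNIV f \<Longrightarrow> integrable torus f"
  unfolding torus_def by (rule continuous_imp_integrable) (rule continuous_on_subset, auto)

section \<open>Lebesgue norms of functions dominated by a product of kernels\<close>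

lemma nn_integral_peak_product:
  assumes L: "L > 0" and r: "r > 1" and "A \<ge> 0"
    and u: "\<And>x. x \<in> cbox 0 (\<chi> i. 2 * pi) \<Longrightarrow> norm (u x) \<le> A * (\<Prod>i\<in>UNIV. peak L (x $ (i::3)))"
  shows "(\<integral>\<^sup>+ x. ennreal (norm (u x) powr r) \<partial>torus)
    \<le> ennreal (A powr r * (2 powr r * 2 / (r - 1) * L powr (r - 1)) ^ 3)"
proof -
  define C where "C = 2 powr r * 2 / (r - 1) * L powr (r - 1)"
  have C: "C \<ge> 0" using r by (simp add: C_def)
  have "(\<integral>\<^sup>+ x. ennreal (norm (u x) powr r) \<partial>torus)
    \<le> (\<integral>\<^sup>+ x. ennreal (A powr r) * (\<Prod>i\<in>UNIV. ennreal (peak L (x $ (i::3)) powr r)) \<partial>torus)"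
  proof (rule nn_integral_mono)
    fix x assume "x \<in> space torus"
    then have x: "x \<in> cbox 0 (\<chi> i. 2 * pi)" by (simp add: torus_def)
    have p: "peak L (x $ i) \<ge> 0" for i
      using x L by (intro peak_nonneg) (auto simp: mem_box_cart)
    have "norm (u x) powr r \<le> (A * (\<Prod>i\<in>UNIV. peak L (x $ (i::3)))) powr r"
      using r by (intro powr_mono2 u x) auto
    also have "\<dots> = A powr r * (\<Prod>i\<in>UNIV. peak L (x $ (i::3)) powr r)"
      using p \<open>A \<ge> 0\<close> by (simp add: powr_mult prod_nonneg prod_powr_distrib)
    finally have "ennreal (norm (u x) powr r) \<le> ennreal (A powr r * (\<Prod>i\<in>UNIV. peak L (x $ (i::3)) powr r))"
      by (rule ennreal_leI)
    also have "\<dots> = ennreal (A powr r) * (\<Prod>i\<in>UNIV. ennreal (peak L (x $ (i::3)) powr r))"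
      by (subst ennreal_mult) (auto intro!: prod_nonneg simp: prod_ennreal)
    finally show "ennreal (norm (u x) powr r) \<le> ennreal (A powr r) * (\<Prod>i\<in>UNIV. ennreal (peak L (x $ (i::3)) powr r))" .
  qed
  also have "\<dots> = ennreal (A powr r) * (\<integral>\<^sup>+ t. ennreal (peak L t powr r) * indicator {0..2 * pi} t \<partial>lborel) ^ 3"
    by (rule nn_integral_torus_prod) (simp add: peak_def[abs_def])
  also have "\<dots> \<le> ennreal (A powr r) * ennreal C ^ 3"
    unfolding C_def by (intro mult_left_mono power_mono nn_integral_peak_powr L r) auto
  also have "\<dots> = ennreal (A powr r * C ^ 3)"
    using C by (simp add: ennreal_power ennreal_mult)
  finally show ?thesis unfolding C_def .
qed

text \<open>For \<open>r = \<infinity>\<close> the quotient \<open>3 / r\<close> is \<open>0\<close>, in accordance with the convention for the Besov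
  exponents.\<close>

lemma Lr_norm_peak_product:
  fixes r :: ennreal
  assumes "1 < r"
  obtains C where "C \<ge> 0" "\<And>A L u. \<lbrakk>A \<ge> 0; L > 0; continuous_on UNIV u;
      \<forall>x\<in>cbox 0 (\<chi> i. 2 * pi). norm (u x) \<le> A * (\<Prod>i\<in>UNIV. peak L (x $ i))\<rbrakk> \<Longrightarrow>
      Lr_norm r u \<le> ennreal (C * A * L powr (3 - enn2real (3 / r)))"
proof (cases "r = \<infinity>")
  case True
  have "Lr_norm r u \<le> ennreal (8 * A * L powr (3 - enn2real (3 / r)))"
    if "A \<ge> 0" "L > 0" and cont: "continuous_on UNIV u"
      and u: "\<forall>x\<in>cbox 0 (\<chi> i. 2 * pi). norm (u x) \<le> A * (\<Prod>i\<in>UNIV. peak L (x $ i))" for A L u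
  proof -
    have [measurable]: "u \<in> borel_measurable borel" using cont by (rule borel_measurable_continuous_onI)
    have "(\<lambda>x. ennreal (norm (u x))) \<in> borel_measurable lebesgue"
      by (rule measurable_completion) measurable
    then have meas: "(\<lambda>x. ennreal (norm (u x))) \<in> borel_measurable torus"
      unfolding torus_def by (rule measurable_restrict_space1)
    have "norm (u x) \<le> 8 * A * L powr 3" if x: "x \<in> cbox 0 (\<chi> i. 2 * pi)" for x
    proof -
      have "(\<Prod>i\<in>UNIV. peak L (x $ i)) \<le> (\<Prod>i\<in>(UNIV::3 set). 2 * L)"
        using x \<open>L > 0\<close> by (intro prod_mono) (auto simp: mem_box_cart intro: peak_nonneg peak_le)
      then have "A * (\<Prod>i\<in>UNIV. peak L (x $ i)) \<le> A * (2 * L) ^ 3"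
        using \<open>A \<ge> 0\<close> by (intro mult_left_mono) auto
      moreover have "norm (u x) \<le> A * (\<Prod>i\<in>UNIV. peak L (x $ i))" using u x by blast
      ultimately show ?thesis using \<open>L > 0\<close> by (simp add: power_mult_distrib mult_ac)
    qed
    then have "AE x in torus. ennreal (norm (u x)) \<le> ennreal (8 * A * L powr 3)"
      by (intro AE_I2 ennreal_leI) (auto simp: torus_def)
    then have "esssup torus (\<lambda>x. ennreal (norm (u x))) \<le> ennreal (8 * A * L powr 3)"
      by (intro esssup_I meas)
    then show ?thesis by (simp add: Lr_norm_def True)
  qed
  then show thesis by (intro that[of 8]) auto
next
  case False
  define \<rho> where "\<rho> = enn2real r"
  have r: "r = ennreal \<rho>" using False by (simp add: \<rho>_def top.not_eq_extremum)
  have \<rho>: "\<rho> > 1" using assms unfolding r by (metis ennreal_1 ennreal_less_iff zero_le_one)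
  have "3 / r = ennreal (3 / \<rho>)" using \<rho> divide_ennreal[of 3 \<rho>] by (simp add: r)
  then have e: "enn2real (3 / r) = 3 / \<rho>" using \<rho> by simp
  define C where "C = (2 powr \<rho> * 2 / (\<rho> - 1)) powr (3 / \<rho>)"
  have "Lr_norm r u \<le> ennreal (C * A * L powr (3 - enn2real (3 / r)))"
    if "A \<ge> 0" "L > 0" and cont: "continuous_on UNIV u"
      and u: "\<forall>x\<in>cbox 0 (\<chi> i. 2 * pi). norm (u x) \<le> A * (\<Prod>i\<in>UNIV. peak L (x $ i))" for A L u
  proof -
    define I where "I = (\<integral>\<^sup>+ x. ennreal (norm (u x) powr \<rho>) \<partial>torus)"
    define D where "D = A powr \<rho> * (2 powr \<rho> * 2 / (\<rho> - 1) * L powr (\<rho> - 1)) ^ 3"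
    have D: "D \<ge> 0" using \<rho> by (simp add: D_def)
    have ID: "I \<le> ennreal D"
      unfolding I_def D_def by (rule nn_integral_peak_product) (use that \<rho> in auto)
    then have I: "I \<noteq> \<infinity>" by (auto simp: top_unique)
    have "enn2real I \<le> D" using ID D by (metis enn2real_leI)
    then have "enn2real I powr (1 / \<rho>) \<le> D powr (1 / \<rho>)" using \<rho> by (intro powr_mono2) auto
    also have "D powr (1 / \<rho>) = A powr 1 * (2 powr \<rho> * 2 / (\<rho> - 1) * L powr (\<rho> - 1)) powr (3 / \<rho>)"
    proof -
      define B where "B = 2 powr \<rho> * 2 / (\<rho> - 1) * L powr (\<rho> - 1)"
      have "B > 0" using \<rho> \<open>L > 0\<close> by (simp add: B_def)
      then have "D = A powr \<rho> * B powr 3" by (simp add: D_def B_def)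
      then have "D powr (1 / \<rho>) = (A powr \<rho>) powr (1 / \<rho>) * (B powr 3) powr (1 / \<rho>)"
        by (simp add: powr_mult)
      also have "\<dots> = A powr 1 * B powr (3 / \<rho>)" using \<rho> by (simp add: powr_powr)
      finally show ?thesis unfolding B_def .
    qed
    also have "\<dots> = C * A * L powr ((\<rho> - 1) * (3 / \<rho>))"
    proof -
      have "(2 powr \<rho> * 2 / (\<rho> - 1) * L powr (\<rho> - 1)) powr (3 / \<rho>) = C * (L powr (\<rho> - 1)) powr (3 / \<rho>)"
        unfolding C_def by (rule powr_mult)
      then show ?thesis using \<open>A \<ge> 0\<close> by (simp add: powr_powr)
    qed
    also have "(\<rho> - 1) * (3 / \<rho>) = 3 - 3 / \<rho>" using \<rho> by (simp add: field_simps)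
    finally show ?thesis using False I
      unfolding Lr_norm_def e \<rho>_def[symmetric] I_def[symmetric] by (simp add: Let_def ennreal_leI)
  qed
  then show thesis by (intro that[of C]) (auto simp: C_def)
qed

section \<open>Lattice boxes\<close>

text \<open>The lattice box with opposite corners \<open>lo\<close> and \<open>hi\<close>, empty unless \<open>lo \<le> hi\<close> in every coordinate.\<close>

definition lattice_box :: "int^3 \<Rightarrow> int^3 \<Rightarrow> (int^3) set" where
  "lattice_box lo hi = {k. \<forall>i. lo $ i \<le> k $ i \<and> k $ i \<le> hi $ i}"

text \<open>Boxes in the lattice, possibly empty, with all edges of length at most \<open>L\<close>.\<close>

definition small_box :: "real \<Rightarrow> (int^3) set \<Rightarrow> bool" where
  "small_box L S \<longleftrightarrow> (\<exists>lo hi. S = lattice_box lo hi \<and> (\<forall>i. real_of_int (hi $ i - lo $ i) \<le> L))"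

lemma small_box_mono:
  assumes "small_box L S" "L \<le> L'" shows "small_box L' S"
proof -
  obtain lo hi where S: "S = lattice_box lo hi" and L: "\<And>i. real_of_int (hi $ i - lo $ i) \<le> L"
    using assms unfolding small_box_def by blast
  have "real_of_int (hi $ i - lo $ i) \<le> L'" for i using L[of i] assms(2) by (rule order_trans)
  then show ?thesis unfolding small_box_def S by blast
qed

lemma small_box_uminus:
  assumes "small_box L S" shows "small_box L (uminus ` S)"
proof -
  obtain lo hi where S: "S = lattice_box lo hi" and L: "\<And>i. real_of_int (hi $ i - lo $ i) \<le> L"
    using assms unfolding small_box_def by blast
  have "uminus ` S = lattice_box (- hi) (- lo)"
  proof (intro set_eqI iffI)
    fix k assume "k \<in> lattice_box (- hi) (- lo)"
    then have "- k \<in> S" by (auto simp: S lattice_box_def minus_le_iff le_minus_iff)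
    then show "k \<in> uminus ` S" by (metis image_eqI minus_minus)
  qed (auto simp: S lattice_box_def)
  then show ?thesis using L unfolding small_box_def by (intro exI conjI) auto
qed

text \<open>The summands must be nonempty: with an empty box as one summand the corners may add up to those of
  a nonempty box.\<close>

lemma small_box_sumset:
  assumes "small_box L A" "small_box L' B" "A \<noteq> {}" "B \<noteq> {}"
  shows "small_box (L + L') {a + b | a b. a \<in> A \<and> b \<in> B}"
proof -
  obtain lo hi where A: "A = lattice_box lo hi" and L: "\<And>i. real_of_int (hi $ i - lo $ i) \<le> L"
    using assms unfolding small_box_def by blast
  obtain lo' hi' where B: "B = lattice_box lo' hi'" and L': "\<And>i. real_of_int (hi' $ i - lo' $ i) \<le> L'"
    using assms unfolding small_box_def by blast
  have le: "lo $ i \<le> hi $ i" "lo' $ i \<le> hi' $ i" for i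
    using assms(3,4) unfolding A B lattice_box_def by (auto intro: order_trans)
  have "{a + b | a b. a \<in> A \<and> b \<in> B} = lattice_box (lo + lo') (hi + hi')"
  proof (intro set_eqI iffI)
    fix k assume k: "k \<in> lattice_box (lo + lo') (hi + hi')"
    \<comment> \<open>the smallest coordinates that \<open>a \<in> A\<close> can have if \<open>k - a\<close> is to lie below \<open>hi'\<close>\<close>
    define a where "a = (\<chi> i. max (lo $ i) (k $ i - hi' $ i))"
    have "a \<in> A" "k - a \<in> B"
      using k le by (auto simp: A B lattice_box_def a_def algebra_simps max_def)
    moreover have "k = a + (k - a)" by simp
    ultimately show "k \<in> {a + b | a b. a \<in> A \<and> b \<in> B}" by blast
  qed (auto simp: A B lattice_box_def intro!: add_mono)
  moreover have "real_of_int ((hi + hi') $ i - (lo + lo') $ i) \<le> L + L'" for i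
    using L[of i] L'[of i] by simp
  ultimately show ?thesis unfolding small_box_def by blast
qed

lemma small_box_real_box:
  assumes "\<And>i. b $ i - a $ i \<le> L"
  shows "small_box L {k. \<forall>i. real_of_int (k $ i) \<in> {a $ i..b $ i}}"
proof -
  have "{k. \<forall>i. real_of_int (k $ i) \<in> {a $ i..b $ i}} = lattice_box (\<chi> i. \<lceil>a $ i\<rceil>) (\<chi> i. \<lfloor>b $ i\<rfloor>)"
    by (auto simp: lattice_box_def ceiling_le_iff le_floor_iff)
  moreover have "real_of_int (\<lfloor>b $ i\<rfloor> - \<lceil>a $ i\<rceil>) \<le> L" for i
    using assms[of i] of_int_floor_le[of "b $ i"] le_of_int_ceiling[of "a $ i"]
    unfolding of_int_diff by linarith
  ultimately show ?thesis unfolding small_box_def by (intro exI conjI) auto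
qed

lemma lattice_box_image:
  "lattice_box lo hi = (\<lambda>(i, j, k). vector [i, j, k]) ` ({lo $ 1..hi $ 1} \<times> {lo $ 2..hi $ 2} \<times> {lo $ 3..hi $ 3})"
proof (intro set_eqI iffI)
  fix k assume k: "k \<in> lattice_box lo hi"
  show "k \<in> (\<lambda>(i, j, k). vector [i, j, k]) ` ({lo $ 1..hi $ 1} \<times> {lo $ 2..hi $ 2} \<times> {lo $ 3..hi $ 3})"
    by (rule image_eqI[of _ _ "(k $ 1, k $ 2, k $ 3)"])
       (use k in \<open>auto simp: lattice_box_def vec_eq_iff forall_3\<close>)
qed (auto simp: lattice_box_def forall_3)

lemma inj_vector_3: "inj (\<lambda>(i, j, k). vector [i, j, k] :: 'a::zero^3)"
  by (auto simp: inj_def vec_eq_iff forall_3)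

lemma sum_lattice_box:
  "(\<Sum>k\<in>lattice_box lo hi. f k) =
    (\<Sum>i\<in>{lo $ 1..hi $ 1}. \<Sum>j\<in>{lo $ 2..hi $ 2}. \<Sum>k\<in>{lo $ 3..hi $ 3}. f (vector [i, j, k]))"
  unfolding lattice_box_image
  by (subst sum.reindex[OF inj_on_subset[OF inj_vector_3]])
     (simp_all add: sum.cartesian_product o_def case_prod_unfold)

lemma finite_small_box: "small_box L S \<Longrightarrow> finite S"
  unfolding small_box_def lattice_box_image by auto

section \<open>Exponential sums with a smooth multiplier\<close>

lemma fdiffs_bound_uniform:
  fixes g :: "'a::euclidean_space \<Rightarrow> real"
  assumes "Ck n g" "\<And>x. norm x > R \<Longrightarrow> g x = 0" "finite V" "\<And>vs. vs \<in> V \<Longrightarrow> length vs \<le> n"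
  shows "\<exists>M\<ge>0. \<forall>vs\<in>V. \<forall>h\<ge>0. \<forall>x. \<bar>foldr fdiff (map (\<lambda>v. h *\<^sub>R v) vs) g x\<bar> \<le> M * h ^ length vs"
proof -
  have "\<exists>M\<ge>0. \<forall>h\<ge>0. \<forall>x. \<bar>foldr fdiff (map (\<lambda>v. h *\<^sub>R v) vs) g x\<bar> \<le> M * h ^ length vs"
    if "vs \<in> V" for vs by (rule fdiffs_bound) (use assms that in auto)
  then obtain m where m: "\<And>vs. vs \<in> V \<Longrightarrow> m vs \<ge> 0"
      "\<And>vs h x. vs \<in> V \<Longrightarrow> h \<ge> 0 \<Longrightarrow> \<bar>foldr fdiff (map (\<lambda>v. h *\<^sub>R v) vs) g x\<bar> \<le> m vs * h ^ length vs"
    by metis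
  have "\<bar>foldr fdiff (map (\<lambda>v. h *\<^sub>R v) vs) g x\<bar> \<le> (\<Sum>vs\<in>V. m vs) * h ^ length vs"
    if "vs \<in> V" "h \<ge> 0" for vs h x
  proof -
    have "m vs \<le> (\<Sum>vs\<in>V. m vs)" by (rule member_le_sum) (use that m assms(3) in auto)
    then show ?thesis using m(2)[OF that, of x] that(2)
      by (meson mult_right_mono order_trans zero_le_power)
  qed
  then show ?thesis by (intro exI[of _ "\<Sum>vs\<in>V. m vs"]) (auto intro: sum_nonneg m)
qed

text \<open>The constant \<open>M\<close> depends on \<open>g\<close> alone, neither on the scale \<open>L\<close> nor on the position of the box.\<close>

lemma exponential_sum_bound:
  fixes g :: "real^3 \<Rightarrow> real"
  assumes "Ck 3 g" "\<And>\<xi>. norm \<xi> > R \<Longrightarrow> g \<xi> = 0"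
  shows "\<exists>M\<ge>0. \<forall>L\<ge>1/2. \<forall>S. small_box L S \<longrightarrow> (\<forall>x\<in>cbox 0 (\<chi> i. 2 * pi).
    norm (\<Sum>k\<in>S. of_real (g ((1 / L) *\<^sub>R of_lattice k)) * cis (of_lattice k \<bullet> x))
      \<le> M * (\<Prod>i\<in>UNIV. peak L (x $ i)))"
proof -
  define e where "e i = (axis i 1 :: real^3)" for i
  \<comment> \<open>one list of directions for each subset of the coordinates\<close>
  define V where "V = {[], [e 1], [e 2], [e 3], [e 2, e 1], [e 3, e 1], [e 3, e 2], [e 3, e 2, e 1]}"
  have "\<exists>M\<ge>0. \<forall>vs\<in>V. \<forall>h\<ge>0. \<forall>x. \<bar>foldr fdiff (map (\<lambda>v. h *\<^sub>R v) vs) g x\<bar> \<le> M * h ^ length vs"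
    by (rule fdiffs_bound_uniform[OF assms]) (auto simp: V_def)
  then obtain M where "M \<ge> 0" and M: "\<And>vs h x. vs \<in> V
      \<Longrightarrow> h \<ge> 0 \<Longrightarrow> \<bar>foldr fdiff (map (\<lambda>v. h *\<^sub>R v) vs) g x\<bar> \<le> M * h ^ length vs"
    by blast
  have "norm (\<Sum>k\<in>S. of_real (g ((1 / L) *\<^sub>R of_lattice k)) * cis (of_lattice k \<bullet> x))
      \<le> 8 * 7 ^ 3 * M * (\<Prod>i\<in>UNIV. peak L (x $ i))"
    if L: "L \<ge> 1 / 2" and S: "small_box L S" and x: "x \<in> cbox 0 (\<chi> i. 2 * pi)" for L S x
  proof -
    obtain lo hi where S: "S = lattice_box lo hi" and lh: "\<And>i. real_of_int (hi $ i - lo $ i) \<le> L"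
      using S unfolding small_box_def by blast
    define h where "h = 1 / L"
    have h: "h \<ge> 0" using L by (simp add: h_def)
    define p where "p i j k = h *\<^sub>R of_lattice (vector [i, j, k])" for i j k
    have p: "p (i + 1) j k = p i j k + h *\<^sub>R e 1" "p i (j + 1) k = p i j k + h *\<^sub>R e 2"
      "p i j (k + 1) = p i j k + h *\<^sub>R e 3" for i j k
      by (auto simp: p_def of_lattice_def vec_eq_iff forall_3 e_def axis_def algebra_simps)
    define m where "m i j k = complex_of_real (g (p i j k))" for i j k
    have D: "norm (complex_of_real (foldr fdiff (map (\<lambda>v. h *\<^sub>R v) vs) g (p i j k))) \<le> M / L ^ length vs"
      if "vs \<in> V" for vs i j k
    proof -
      have "M / L ^ length vs = M * h ^ length vs" by (simp add: h_def power_one_over)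
      then show ?thesis unfolding norm_of_real using M[OF that h, of "p i j k"] by (simp only:)
    qed
    have K: "norm (\<Sum>k\<in>{lo $ i..b'}. cis (of_int k * x $ i)) \<le> 7 * peak L (x $ i)"
      if "b' \<le> hi $ i" for b' i
      by (rule dirichlet_kernel_bound)
         (use L lh[of i] that x in \<open>auto simp: mem_box_cart\<close>)
    have "(\<Sum>k\<in>S. of_real (g ((1 / L) *\<^sub>R of_lattice k)) * cis (of_lattice k \<bullet> x))
      = (\<Sum>i\<in>{lo $ 1..hi $ 1}. (\<Sum>j\<in>{lo $ 2..hi $ 2}. (\<Sum>k\<in>{lo $ 3..hi $ 3}.
           m i j k * cis (of_int k * x $ 3)) * cis (of_int j * x $ 2)) * cis (of_int i * x $ 1))"
      unfolding S sum_lattice_box sum_distrib_right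
      by (intro sum.cong refl)
         (simp add: m_def p_def h_def inner_vec_def sum_3 of_lattice_def cis_mult[symmetric] mult_ac)
    also have "norm \<dots> \<le> 8 * (7 * peak L (x $ 1)) * (7 * peak L (x $ 2)) * (7 * peak L (x $ 3)) * M"
    proof (rule summation_by_parts_bound_3[where m = m and L = L])
      fix i j k
      show "norm (m i j k) \<le> M"
        using D[of "[]" i j k] by (simp add: m_def V_def)
      show "norm (m (i + 1) j k - m i j k) \<le> M / L"
        using D[of "[e 1]" i j k] unfolding m_def p(1) unfolding p(2) unfolding p(3) by (simp add: V_def fdiff_def del: norm_of_real)
      show "norm (m i (j + 1) k - m i j k) \<le> M / L"
        using D[of "[e 2]" i j k] unfolding m_def p(1) unfolding p(2) unfolding p(3) by (simp add: V_def fdiff_def del: norm_of_real)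
      show "norm (m i j (k + 1) - m i j k) \<le> M / L"
        using D[of "[e 3]" i j k] unfolding m_def p(1) unfolding p(2) unfolding p(3) by (simp add: V_def fdiff_def del: norm_of_real)
      show "norm ((m (i + 1) (j + 1) k - m i (j + 1) k) - (m (i + 1) j k - m i j k)) \<le> M / L\<^sup>2"
        using D[of "[e 2, e 1]" i j k] unfolding m_def p(1) unfolding p(2) unfolding p(3) by (simp add: V_def fdiff_def power2_eq_square del: norm_of_real)
      show "norm ((m (i + 1) j (k + 1) - m i j (k + 1)) - (m (i + 1) j k - m i j k)) \<le> M / L\<^sup>2"
        using D[of "[e 3, e 1]" i j k] unfolding m_def p(1) unfolding p(2) unfolding p(3) by (simp add: V_def fdiff_def power2_eq_square del: norm_of_real)
      show "norm ((m i (j + 1) (k + 1) - m i j (k + 1)) - (m i (j + 1) k - m i j k)) \<le> M / L\<^sup>2"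
        using D[of "[e 3, e 2]" i j k] unfolding m_def p(1) unfolding p(2) unfolding p(3) by (simp add: V_def fdiff_def power2_eq_square del: norm_of_real)
      show "norm (((m (i + 1) (j + 1) (k + 1) - m i (j + 1) (k + 1)) - (m (i + 1) j (k + 1) - m i j (k + 1)))
         - ((m (i + 1) (j + 1) k - m i (j + 1) k) - (m (i + 1) j k - m i j k))) \<le> M / L ^ 3"
        using D[of "[e 3, e 2, e 1]" i j k] unfolding m_def p(1) unfolding p(2) unfolding p(3) by (simp add: V_def fdiff_def power3_eq_cube del: norm_of_real)
      show "L > 0" using L by simp
      show "real_of_int (hi $ 1 - lo $ 1) \<le> L" "real_of_int (hi $ 2 - lo $ 2) \<le> L"
        "real_of_int (hi $ 3 - lo $ 3) \<le> L" "M \<ge> 0"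
        by (rule lh \<open>M \<ge> 0\<close>)+
    qed (rule K, assumption)+
    also have "\<dots> = 8 * 7 ^ 3 * M * (\<Prod>i\<in>UNIV. peak L (x $ i))"
      unfolding UNIV_3 by simp
    finally show ?thesis .
  qed
  then show ?thesis using \<open>M \<ge> 0\<close> by (intro exI[of _ "8 * 7 ^ 3 * M"]) auto
qed

section \<open>The Leray symbol as a multiplier\<close>

lemma smoothD: "smooth f \<Longrightarrow> Ck n f"
  by (simp add: smooth_def)

lemma lp_cutoffD:
  assumes "lp_cutoff chi"
  shows "smooth chi" "0 \<le> chi \<xi>" "norm \<xi> \<le> 1 / 2 \<Longrightarrow> chi \<xi> = 1" "norm \<xi> \<ge> 1 \<Longrightarrow> chi \<xi> = 0"
  using assms unfolding lp_cutoff_def by blast+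

lemma leray_nth: "leray \<xi> $ i $ m = (if i = m then 1 else 0) - \<xi> $ i * \<xi> $ m / (norm \<xi>)\<^sup>2"
  by (simp add: leray_def mat_def)

text \<open>The Leray symbol is singular at the origin. Adding \<open>chi (2 \<xi>)\<close> to the denominator \<open>\<bar>\<xi>\<bar>\<^sup>2\<close> removes the
  singularity and changes nothing for \<open>\<bar>\<xi>\<bar> \<ge> 1 / 2\<close>, where alone \<open>h\<close> may differ from zero. The symbol is
  homogeneous of degree zero, so rescaling its argument by \<open>L\<close> is harmless.\<close>

lemma leray_multiplier:
  assumes chi: "lp_cutoff chi" and h: "smooth h" "\<And>\<xi>. norm \<xi> \<le> 1 / 2 \<Longrightarrow> h \<xi> = 0"
  obtains g where "Ck 3 g" "\<And>\<xi>. h \<xi> = 0 \<Longrightarrow> g \<xi> = 0"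
    "\<And>L k. L > 0 \<Longrightarrow> g ((1 / L) *\<^sub>R of_lattice k) = h ((1 / L) *\<^sub>R of_lattice k) * leray (of_lattice k) $ i $ m"
proof -
  define d where "d \<xi> = (\<Sum>i\<in>UNIV. \<xi> $ i * \<xi> $ i) + chi (2 *\<^sub>R \<xi>)" for \<xi>
  define g where "g \<xi> = h \<xi> * ((if i = m then 1 else 0) - \<xi> $ i * \<xi> $ m * inverse (d \<xi>))" for \<xi>
  have norm: "(\<Sum>i\<in>UNIV. \<xi> $ i * \<xi> $ i) = (norm \<xi>)\<^sup>2" for \<xi> :: "real^3"
    by (simp add: power2_norm_eq_inner inner_vec_def)
  have d0: "d \<xi> \<noteq> 0" for \<xi>
  proof (cases "\<xi> = 0")
    case True
    then show ?thesis using lp_cutoffD(3)[OF chi, of 0] by (simp add: d_def)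
  next
    case False
    then have "(norm \<xi>)\<^sup>2 > 0" by simp
    moreover have "chi (2 *\<^sub>R \<xi>) \<ge> 0" by (rule lp_cutoffD(2)[OF chi])
    ultimately show ?thesis unfolding d_def norm by linarith
  qed
  have coord: "Ck n (\<lambda>\<xi>::real^3. \<xi> $ i)" for n i
    by (rule Ck_bounded_linear) (rule bounded_linear_vec_nth)
  have chi': "Ck 3 (\<lambda>\<xi>. chi (2 *\<^sub>R \<xi>))"
    by (rule Ck_scale[OF smoothD[OF lp_cutoffD(1)[OF chi]]])
  have "Ck 3 d"
    unfolding d_def[abs_def] sum_3 by (intro Ck_add Ck_mult coord chi')
  then have "Ck 3 (\<lambda>\<xi>. inverse (d \<xi>))" by (rule Ck_inverse) (rule d0)
  then have 1: "Ck 3 g"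
    unfolding g_def[abs_def]
    by (rule Ck_mult[OF smoothD[OF h(1)] Ck_diff[OF Ck_const Ck_mult[OF Ck_mult[OF coord coord]]]])
  have 2: "g \<xi> = 0" if "h \<xi> = 0" for \<xi> using that by (simp add: g_def)
  have 3: "g ((1 / L) *\<^sub>R of_lattice k) = h ((1 / L) *\<^sub>R of_lattice k) * leray (of_lattice k) $ i $ m"
    if "L > 0" for L k
  proof (cases "norm ((1 / L) *\<^sub>R of_lattice k) \<le> 1 / 2")
    case True
    then show ?thesis using h(2) by (simp add: g_def)
  next
    case False
    define \<xi> where "\<xi> = of_lattice k"
    have "norm (2 *\<^sub>R (1 / L) *\<^sub>R \<xi>) \<ge> 1" using False unfolding \<xi>_def by (simp add: mult.commute not_le)
    then have "chi (2 *\<^sub>R (1 / L) *\<^sub>R \<xi>) = 0" by (rule lp_cutoffD(4)[OF chi])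
    then have d: "d ((1 / L) *\<^sub>R \<xi>) = (norm \<xi>)\<^sup>2 / L\<^sup>2"
      unfolding d_def norm using \<open>L > 0\<close> by (simp add: power_divide)
    have "((1 / L) *\<^sub>R \<xi>) $ i * ((1 / L) *\<^sub>R \<xi>) $ m * inverse ((norm \<xi>)\<^sup>2 / L\<^sup>2)
        = \<xi> $ i * \<xi> $ m / (norm \<xi>)\<^sup>2"
    proof -
      have "((1 / L) *\<^sub>R \<xi>) $ i * ((1 / L) *\<^sub>R \<xi>) $ m = \<xi> $ i * \<xi> $ m / L\<^sup>2"
        by (simp add: power2_eq_square)
      then show ?thesis using \<open>L > 0\<close> by (simp only:) simp
    qed
    then show ?thesis
      unfolding g_def leray_nth \<xi>_def[symmetric] d by simp
  qed
  show thesis by (rule that[OF 1 2 3])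
qed

section \<open>The layers of the vector field\<close>

text \<open>The Fourier coefficients of the \<open>j\<close>-th term of the series defining the vector field.\<close>

definition layer :: "real \<Rightarrow> (nat \<Rightarrow> nat) \<Rightarrow> nat \<Rightarrow> int^3 \<Rightarrow> complex^3" where
  "layer c q j k = coeffs_U_q c q j k + coeffs_U_q_minus_1 c q j k"

lemma lam_pos: "lam p > 0"
  by (simp add: lam_def)

lemma lam_minus_1: "lam (p - 1) = lam p / 2"
  by (simp add: lam_def power_int_diff)

lemma lam_of_nat: "lam (int n) = 2 ^ n"
  by (simp add: lam_def power_int_of_nat)

lemma blockA_small_box:
  assumes "c > 0" shows "small_box (2 * c * lam (int (q j))) (blockA c q j)"
proof -
  define l where "l = lam (int (q j))"
  define a b where "a = (vector [(1 - c) * l, - c * l, - c * l] :: real^3)"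
    and "b = (vector [(1 + c) * l, c * l, c * l] :: real^3)"
  have "blockA c q j = {k. \<forall>i. real_of_int (k $ i) \<in> {a $ i..b $ i}}"
    by (simp add: blockA_def Let_def forall_3 a_def b_def l_def)
  moreover have "b $ i - a $ i \<le> 2 * c * l" for i
  proof -
    have "\<forall>i. b $ i - a $ i \<le> 2 * c * l" unfolding forall_3 a_def b_def by (simp add: algebra_simps)
    then show ?thesis ..
  qed
  ultimately show ?thesis using small_box_real_box unfolding l_def by simp
qed

lemma blockB_small_box:
  assumes "c > 0" shows "small_box (c * lam (int (q j))) (blockB c q j)"
proof -
  define l where "l = lam (int (q j) - 1)"
  define a b where "a = (vector [- c * l, - c * l, (1 - c) * l] :: real^3)"
    and "b = (vector [c * l, c * l, (1 + c) * l] :: real^3)"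
  have "blockB c q j = {k. \<forall>i. real_of_int (k $ i) \<in> {a $ i..b $ i}}"
    by (simp add: blockB_def Let_def forall_3 a_def b_def l_def)
  moreover have "b $ i - a $ i \<le> c * (2 * l)" for i
  proof -
    have "\<forall>i. b $ i - a $ i \<le> c * (2 * l)" unfolding forall_3 a_def b_def by (simp add: algebra_simps)
    then show ?thesis ..
  qed
  moreover have "2 * l = lam (int (q j))" by (simp add: l_def lam_minus_1)
  ultimately show ?thesis using small_box_real_box by simp
qed

lemma blocks_nonempty:
  assumes "c > 0" "q j > 0" shows "blockA c q j \<noteq> {}" "blockB c q j \<noteq> {}"
proof -
  have "vector [2 ^ q j, 0, 0] \<in> blockA c q j"
    using assms by (simp add: blockA_def Let_def lam_of_nat algebra_simps)
  then show "blockA c q j \<noteq> {}" by blast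
  have "lam (int (q j) - 1) = 2 ^ (q j - 1)"
    using assms lam_of_nat[of "q j - 1"] by (simp add: of_nat_diff)
  then have "vector [0, 0, 2 ^ (q j - 1)] \<in> blockB c q j"
    using assms by (simp add: blockB_def Let_def algebra_simps)
  then show "blockB c q j \<noteq> {}" by blast
qed

lemma blockC_small_box:
  assumes "c > 0" "q j > 0" shows "small_box (3 * c * lam (int (q j))) (blockC c q j)"
proof -
  have "small_box (2 * c * lam (int (q j)) + c * lam (int (q j))) (blockC c q j)"
    unfolding blockC_def
    by (intro small_box_sumset blockA_small_box blockB_small_box blocks_nonempty assms)
  then show ?thesis by (simp add: algebra_simps)
qed

text \<open>A finite set outside of which the coefficients of the \<open>j\<close>-th term vanish: the union of its six
  boxes.\<close>

definition layer_support :: "real \<Rightarrow> (nat \<Rightarrow> nat) \<Rightarrow> nat \<Rightarrow> (int^3) set" where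
  "layer_support c q j = (blockA c q j \<union> uminus ` blockA c q j) \<union> (blockB c q j \<union> uminus ` blockB c q j)
     \<union> (blockC c q j \<union> uminus ` blockC c q j)"

lemma layer_blocks_small:
  assumes "c > 0" "q j > 0" "3 * c * lam (int (q j)) \<le> L"
  shows "small_box L (blockA c q j)" "small_box L (uminus ` blockA c q j)"
    "small_box L (blockB c q j)" "small_box L (uminus ` blockB c q j)"
    "small_box L (blockC c q j)" "small_box L (uminus ` blockC c q j)"
proof -
  have cl: "c * lam (int (q j)) > 0" using assms lam_pos by simp
  show A: "small_box L (blockA c q j)"
    by (rule small_box_mono[OF blockA_small_box]) (use assms cl in \<open>auto simp: mult.assoc\<close>)
  show B: "small_box L (blockB c q j)"
    by (rule small_box_mono[OF blockB_small_box]) (use assms cl in \<open>auto simp: mult.assoc\<close>)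
  show C: "small_box L (blockC c q j)"
    by (rule small_box_mono[OF blockC_small_box]) (use assms in auto)
  show "small_box L (uminus ` blockA c q j)" "small_box L (uminus ` blockB c q j)"
     "small_box L (uminus ` blockC c q j)" using A B C by (auto intro: small_box_uminus)
qed

lemma finite_layer_support: "c > 0 \<Longrightarrow> q j > 0 \<Longrightarrow> finite (layer_support c q j)"
  unfolding layer_support_def
  using layer_blocks_small[of c q j, OF _ _ order_refl, THEN finite_small_box] by blast

lemma layer_outside:
  assumes "k \<notin> layer_support c q j"
  shows "coeffs_U_q c q j k = 0" "coeffs_U_q_minus_1 c q j k = 0" "layer c q j k = 0"
proof -
  show 1: "coeffs_U_q c q j k = 0" using assms unfolding coeffs_U_q_def layer_support_def by (simp add: vec_eq_iff)
  show 2: "coeffs_U_q_minus_1 c q j k = 0"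
    using assms unfolding coeffs_U_q_minus_1_def layer_support_def by (simp add: vec_eq_iff)
  show "layer c q j k = 0" by (simp add: layer_def 1 2)
qed

text \<open>The \<open>j\<close>-th term lives at frequencies comparable to \<open>lam (q j)\<close>.\<close>

lemma layer_frequencies:
  assumes c: "0 < c" "c < 1 / 24" and "layer c q j k \<noteq> 0"
  shows "lam (int (q j)) / 4 \<le> norm (of_lattice k)" "norm (of_lattice k) \<le> 2 * lam (int (q j))"
proof -
  define l where "l = lam (int (q j))"
  have l: "l > 0" unfolding l_def by (rule lam_pos)
  define d where "d = c * l"
  have "d > 0" "24 * d < l" using c l by (auto simp: d_def)
  have *: "l / 4 \<le> norm (of_lattice k) \<and> norm (of_lattice k) \<le> 2 * l"
    if "\<bar>of_lattice k $ 1\<bar> \<ge> l / 4 \<or> \<bar>of_lattice k $ 3\<bar> \<ge> l / 4"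
      "\<bar>of_lattice k $ 1\<bar> + \<bar>of_lattice k $ 2\<bar> + \<bar>of_lattice k $ 3\<bar> \<le> 2 * l" for k
    using that component_le_norm_cart[of "of_lattice k" 1] component_le_norm_cart[of "of_lattice k" 3]
      norm_le_l1_cart[of "of_lattice k"] by (auto simp: sum_3)
  have A: "l - d \<le> k $ 1" "k $ 1 \<le> l + d" "\<bar>real_of_int (k $ 2)\<bar> \<le> d" "\<bar>real_of_int (k $ 3)\<bar> \<le> d"
    if "k \<in> blockA c q j" for k using that by (auto simp: blockA_def l_def d_def Let_def algebra_simps)
  have B: "2 * \<bar>real_of_int (k $ 1)\<bar> \<le> d" "2 * \<bar>real_of_int (k $ 2)\<bar> \<le> d"
    "l - d \<le> 2 * real_of_int (k $ 3)" "2 * real_of_int (k $ 3) \<le> l + d"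
    if "k \<in> blockB c q j" for k
    using that by (auto simp: blockB_def l_def d_def Let_def lam_minus_1 algebra_simps diff_divide_distrib add_divide_distrib)
  have fA: "l / 4 \<le> norm (of_lattice k) \<and> norm (of_lattice k) \<le> 2 * l" if "k \<in> blockA c q j" for k
    by (rule *[OF disjI1]; unfold of_lattice_def vec_lambda_beta) (use A[OF that] \<open>d > 0\<close> \<open>24 * d < l\<close> in linarith)+
  have fB: "l / 4 \<le> norm (of_lattice k) \<and> norm (of_lattice k) \<le> 2 * l" if "k \<in> blockB c q j" for k
    by (rule *[OF disjI2]; unfold of_lattice_def vec_lambda_beta) (use B[OF that] \<open>d > 0\<close> \<open>24 * d < l\<close> in linarith)+
  have fC: "l / 4 \<le> norm (of_lattice k) \<and> norm (of_lattice k) \<le> 2 * l" if kC: "k \<in> blockC c q j" for k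
  proof -
    obtain a b where k: "k = a + b" and a: "a \<in> blockA c q j" and b: "b \<in> blockB c q j"
      using kC unfolding blockC_def by blast
    show ?thesis
      by (rule *[OF disjI1]; unfold k of_lattice_def vec_lambda_beta vector_add_component of_int_add)
         (use A[OF a] B[OF b] \<open>d > 0\<close> \<open>24 * d < l\<close> in linarith)+
  qed
  have minus: "norm (of_lattice (- k)) = norm (of_lattice k)" for k
  proof -
    have "of_lattice (- k) = - of_lattice k" by (simp add: of_lattice_def vec_eq_iff)
    then show ?thesis by simp
  qed
  have "k \<in> layer_support c q j" using assms layer_outside(3) by blast
  then have "l / 4 \<le> norm (of_lattice k) \<and> norm (of_lattice k) \<le> 2 * l"
    unfolding layer_support_def using fA fB fC by (auto simp: minus)
  then show "lam (int (q j)) / 4 \<le> norm (of_lattice k)" "norm (of_lattice k) \<le> 2 * lam (int (q j))"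
    by (auto simp: l_def)
qed

lemma scaleR_nth_complex: "(r *\<^sub>R v) $ i = of_real r * v $ i" for v :: "complex^'n"
  by (simp add: scaleR_conv_of_real[where 'a = complex])

text \<open>The boxes of each of the pairs \<open>A, -A\<close> and \<open>B, -B\<close> are disjoint, so that the indicator of the union
  is the sum of the indicators and the layer is a combination of six boxes.\<close>

lemma layer_nth:
  assumes "c < 1"
  shows "layer c q j k $ i = of_real (1 / (lam (int (q j)))\<^sup>2) *
    ((indicator (blockA c q j) k + indicator (uminus ` blockA c q j) k) * of_real (leray (of_lattice k) $ i $ 2)
     + (indicator (blockC c q j) k - indicator (uminus ` blockC c q j) k) *
        (\<i> * (of_real (leray (of_lattice k) $ i $ 2) - of_real (leray (of_lattice k) $ i $ 1)))
     + (indicator (blockB c q j) k + indicator (uminus ` blockB c q j) k) * of_real (leray (of_lattice k) $ i $ 1))"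
proof -
  have "k $ 1 > 0" if "k \<in> blockA c q j" for k
  proof -
    have "(1 - c) * lam (int (q j)) \<le> real_of_int (k $ 1)" using that by (simp add: blockA_def Let_def)
    moreover have "(1 - c) * lam (int (q j)) > 0" using assms lam_pos by simp
    ultimately show ?thesis by linarith
  qed
  note pos = this
  have A: "blockA c q j \<inter> uminus ` blockA c q j = {}"
  proof (rule equals0I)
    fix k assume "k \<in> blockA c q j \<inter> uminus ` blockA c q j"
    then obtain k' where "k \<in> blockA c q j" "k = - k'" "k' \<in> blockA c q j" by blast
    then show False using pos[of k] pos[of k'] by simp
  qed
  have "k $ 3 > 0" if "k \<in> blockB c q j" for k
  proof -
    have "(1 - c) * lam (int (q j) - 1) \<le> real_of_int (k $ 3)" using that by (simp add: blockB_def Let_def)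
    moreover have "(1 - c) * lam (int (q j) - 1) > 0" using assms lam_pos by simp
    ultimately show ?thesis by linarith
  qed
  note pos = this
  have B: "blockB c q j \<inter> uminus ` blockB c q j = {}"
  proof (rule equals0I)
    fix k assume "k \<in> blockB c q j \<inter> uminus ` blockB c q j"
    then obtain k' where "k \<in> blockB c q j" "k = - k'" "k' \<in> blockB c q j" by blast
    then show False using pos[of k] pos[of k'] by simp
  qed
  have ind: "indicator (S \<union> T) k = indicator S k + (indicator T k :: complex)" if "S \<inter> T = {}" for S T :: "(int^3) set"
    using that by (auto simp: indicator_def)
  have e: "leray_e m k $ i = of_real (leray (of_lattice k) $ i $ m)" for m
    by (simp add: leray_e_def matrix_vector_mul_component inner_axis)
  show ?thesis
    unfolding layer_def coeffs_U_q_def coeffs_U_q_minus_1_def ind[OF A] ind[OF B] vector_add_component scaleR_nth_complex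
      distrib_left[symmetric]
    by (simp only: e vector_add_component vector_minus_component vector_smult_component) (simp add: algebra_simps)
qed

section \<open>Fourier series with finitely many terms\<close>

lemma fourier_series_finite:
  assumes "finite T" "\<And>k. k \<notin> T \<Longrightarrow> a k = 0"
  shows "fourier_series a x = (\<Sum>k\<in>T. cis (of_lattice k \<bullet> x) *s a k)"
proof -
  have "fourier_series a x = (\<Sum>\<^sub>\<infinity>k\<in>T. cis (of_lattice k \<bullet> x) *s a k)"
    unfolding fourier_series_def by (rule infsum_cong_neutral) (use assms in auto)
  then show ?thesis using assms by simp
qed

lemma continuous_on_scalar_mult_cart [continuous_intros]:
  fixes f :: "_ \<Rightarrow> complex" and g :: "_ \<Rightarrow> complex^'n"
  assumes "continuous_on S f" "continuous_on S g"
  shows "continuous_on S (\<lambda>x. f x *s g x)"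
  unfolding vector_scalar_mult_def by (intro continuous_intros assms)

lemma continuous_fourier_series:
  assumes "finite T" "\<And>k. k \<notin> T \<Longrightarrow> a k = 0"
  shows "continuous_on UNIV (fourier_series a)"
proof -
  have "fourier_series a = (\<lambda>x. \<Sum>k\<in>T. cis (of_lattice k \<bullet> x) *s a k)"
    by (rule ext) (rule fourier_series_finite[OF assms])
  then show ?thesis by (simp add: continuous_intros)
qed

lemma norm_cart_le_sum: "norm (v :: complex^3) \<le> (\<Sum>i\<in>UNIV. norm (v $ i))"
  unfolding norm_vec_def by (rule L2_set_le_sum) simp

section \<open>Kernel bound for a frequency-localized layer\<close>

text \<open>The constant \<open>M\<close> depends on \<open>chi\<close> and the profile \<open>h\<close> only. The scale \<open>L\<close> of the multiplier need
  only dominate \<open>3 c lam (q j)\<close>, a bound for the side lengths of the blocks.\<close>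

lemma localized_layer_bound:
  assumes chi: "lp_cutoff chi" and h: "smooth h" "\<And>\<xi>. norm \<xi> \<le> 1 / 2 \<Longrightarrow> h \<xi> = 0"
    "\<And>\<xi>. norm \<xi> > R \<Longrightarrow> h \<xi> = 0"
  obtains M where "M \<ge> 0" "\<And>L c q j x. \<lbrakk>1 / 2 \<le> L; 0 < c; c < 1; 0 < q j;
      3 * c * lam (int (q j)) \<le> L; x \<in> cbox 0 (\<chi> i. 2 * pi)\<rbrakk> \<Longrightarrow>
      norm (fourier_series (\<lambda>k. h ((1 / L) *\<^sub>R of_lattice k) *\<^sub>R layer c q j k) x)
        \<le> M / (lam (int (q j)))\<^sup>2 * (\<Prod>i\<in>UNIV. peak L (x $ i))"
proof -
  \<comment> \<open>the bound for one entry of the Leray symbol and an arbitrary small box\<close>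
  define B where "B i n M \<longleftrightarrow> (\<forall>L\<ge>1/2. \<forall>S. small_box L S \<longrightarrow> (\<forall>x\<in>cbox 0 (\<chi> i. 2 * pi).
    norm (\<Sum>k\<in>S. of_real (h ((1 / L) *\<^sub>R of_lattice k) * leray (of_lattice k) $ i $ n) * cis (of_lattice k \<bullet> x))
      \<le> M * (\<Prod>i\<in>UNIV. peak L (x $ i))))" for i n M
  have "\<exists>M\<ge>0. B i n M" for i n
  proof -
    obtain g where g: "Ck 3 g" "\<And>\<xi>. h \<xi> = 0 \<Longrightarrow> g \<xi> = 0"
      "\<And>L k. L > 0 \<Longrightarrow> g ((1 / L) *\<^sub>R of_lattice k) = h ((1 / L) *\<^sub>R of_lattice k) * leray (of_lattice k) $ i $ n"
      by (rule leray_multiplier[OF chi h(1,2), where i = i and m = n]) auto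
    have g': "h ((1 / L) *\<^sub>R of_lattice k) * leray (of_lattice k) $ i $ n = g ((1 / L) *\<^sub>R of_lattice k)"
      if "L \<ge> 1 / 2" for L k using g(3)[of L k] that by simp
    from exponential_sum_bound[OF g(1) g(2)[OF h(3)]] obtain M where "M \<ge> 0" and
      M: "\<forall>L\<ge>1/2. \<forall>S. small_box L S \<longrightarrow> (\<forall>x\<in>cbox 0 (\<chi> i. 2 * pi).
      norm (\<Sum>k\<in>S. of_real (g ((1 / L) *\<^sub>R of_lattice k)) * cis (of_lattice k \<bullet> x))
      \<le> M * (\<Prod>i\<in>UNIV. peak L (x $ i)))"
      by blast
    have "B i n M"
      unfolding B_def
    proof (intro allI impI ballI)
      fix L :: real and S and x :: "real^3"
      assume L: "L \<ge> 1 / 2" and S: "small_box L S" and x: "x \<in> cbox 0 (\<chi> i. 2 * pi)"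
      show "norm (\<Sum>k\<in>S. of_real (h ((1 / L) *\<^sub>R of_lattice k) * leray (of_lattice k) $ i $ n) * cis (of_lattice k \<bullet> x))
        \<le> M * (\<Prod>i\<in>UNIV. peak L (x $ i))"
        unfolding g'[OF L] using M L S x by blast
    qed
    then show ?thesis using \<open>M \<ge> 0\<close> by blast
  qed
  then obtain m where m0: "\<And>i n. m i n \<ge> 0" and mB: "\<And>i n. B i n (m i n)" by metis
  have m: "norm (\<Sum>k\<in>S. of_real (h ((1 / L) *\<^sub>R of_lattice k) * leray (of_lattice k) $ i $ n) * cis (of_lattice k \<bullet> x))
      \<le> m i n * (\<Prod>i\<in>UNIV. peak L (x $ i))"
    if "L \<ge> 1 / 2" "small_box L S" "x \<in> cbox 0 (\<chi> i. 2 * pi)" for i n L S x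
    using mB[of i n] that unfolding B_def by blast
  define M where "M = (\<Sum>i\<in>UNIV. 4 * m i 2 + 4 * m i 1)"
  have "M \<ge> 0" unfolding M_def by (intro sum_nonneg) (simp add: m0)
  moreover have "norm (fourier_series (\<lambda>k. h ((1 / L) *\<^sub>R of_lattice k) *\<^sub>R layer c q j k) x)
        \<le> M / (lam (int (q j)))\<^sup>2 * (\<Prod>i\<in>UNIV. peak L (x $ i))"
    if L: "1 / 2 \<le> L" and c: "0 < c" "c < 1" and q: "0 < q j" and cL: "3 * c * lam (int (q j)) \<le> L"
      and x: "x \<in> cbox 0 (\<chi> i. 2 * pi)" for L c q j x
  proof -
    define T where "T = layer_support c q j"
    have T: "finite T" unfolding T_def using c q by (intro finite_layer_support)
    define F where "F = fourier_series (\<lambda>k. h ((1 / L) *\<^sub>R of_lattice k) *\<^sub>R layer c q j k) x"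
    define P where "P = (\<Prod>i\<in>UNIV. peak L (x $ i))"
    define l where "l = lam (int (q j))"
    have F: "F = (\<Sum>k\<in>T. cis (of_lattice k \<bullet> x) *s (h ((1 / L) *\<^sub>R of_lattice k) *\<^sub>R layer c q j k))"
      unfolding F_def by (rule fourier_series_finite[OF T]) (simp add: T_def layer_outside)
    have comp: "norm (F $ i) \<le> (1 / l\<^sup>2) * ((4 * m i 2 + 4 * m i 1) * P)" for i
    proof -
      define w where "w n k = of_real (h ((1 / L) *\<^sub>R of_lattice k) * leray (of_lattice k) $ i $ n) * cis (of_lattice k \<bullet> x)" for n k
      have W: "norm (\<Sum>k\<in>S. w n k) \<le> m i n * P" if "small_box L S" for S n
        unfolding w_def P_def by (rule m[OF L that x])
      have S: "(\<Sum>k\<in>T. indicator S k * w n k) = (\<Sum>k\<in>S. w n k)" if "S \<subseteq> T" for S n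
        using T that by (simp add: indicator_times_eq_if sum.If_cases Int_absorb1)
      note sub = T_def layer_support_def
      have AT: "blockA c q j \<subseteq> T" "uminus ` blockA c q j \<subseteq> T" "blockB c q j \<subseteq> T" "uminus ` blockB c q j \<subseteq> T"
         "blockC c q j \<subseteq> T" "uminus ` blockC c q j \<subseteq> T" unfolding sub by blast+
      have "F $ i = (\<Sum>k\<in>T. of_real (1 / l\<^sup>2) *
         ((indicator (blockA c q j) k * w 2 k + indicator (uminus ` blockA c q j) k * w 2 k)
        + \<i> * ((indicator (blockC c q j) k * w 2 k - indicator (uminus ` blockC c q j) k * w 2 k)
        - (indicator (blockC c q j) k * w 1 k - indicator (uminus ` blockC c q j) k * w 1 k))
        + (indicator (blockB c q j) k * w 1 k + indicator (uminus ` blockB c q j) k * w 1 k)))"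
        unfolding F l_def w_def sum_component
        by (intro sum.cong refl)
           (simp only: layer_nth[OF \<open>c < 1\<close>] scaleR_nth_complex vector_smult_component of_real_mult,
            simp only: algebra_simps)
      also have "\<dots> = of_real (1 / l\<^sup>2) *
         (((\<Sum>k\<in>blockA c q j. w 2 k) + (\<Sum>k\<in>uminus ` blockA c q j. w 2 k))
        + \<i> * (((\<Sum>k\<in>blockC c q j. w 2 k) - (\<Sum>k\<in>uminus ` blockC c q j. w 2 k))
        - ((\<Sum>k\<in>blockC c q j. w 1 k) - (\<Sum>k\<in>uminus ` blockC c q j. w 1 k)))
        + ((\<Sum>k\<in>blockB c q j. w 1 k) + (\<Sum>k\<in>uminus ` blockB c q j. w 1 k)))"
        by (simp only: sum_distrib_left[symmetric] sum.distrib sum_subtractf S[OF AT(1)] S[OF AT(2)]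
             S[OF AT(3)] S[OF AT(4)] S[OF AT(5)] S[OF AT(6)])
      also have "norm \<dots> \<le> (1 / l\<^sup>2) * (((m i 2 * P + m i 2 * P) + ((m i 2 * P + m i 2 * P) + (m i 1 * P + m i 1 * P)))
          + (m i 1 * P + m i 1 * P))"
      proof -
        have l2: "norm (complex_of_real (1 / l\<^sup>2)) = 1 / l\<^sup>2" unfolding norm_of_real by simp
        note W' = layer_blocks_small[where q = q and j = j, OF c(1) q cL, THEN W]
        have i: "norm (\<i> * z) \<le> r" if "norm z \<le> r" for z r using that by (simp add: norm_mult)
        have sub: "norm (y - z) \<le> r + s" if "norm y \<le> r" "norm z \<le> s" for y z :: complex and r s
          using norm_triangle_ineq4[of y z] that by linarith
        show ?thesis unfolding norm_mult[of "complex_of_real (1 / l\<^sup>2)"] l2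
          by (intro mult_left_mono norm_triangle_mono sub i W') simp
      qed
      finally show ?thesis by (simp add: algebra_simps)
    qed
    have "norm F \<le> (\<Sum>i\<in>UNIV. (1 / l\<^sup>2) * ((4 * m i 2 + 4 * m i 1) * P))"
      by (rule order_trans[OF norm_cart_le_sum]) (intro sum_mono comp)
    also have "\<dots> = M / l\<^sup>2 * P" by (simp add: M_def sum_distrib_right sum_distrib_left sum_divide_distrib)
    finally show ?thesis unfolding F_def l_def P_def .
  qed
  ultimately show thesis by (rule that)
qed

section \<open>The vector field is a distribution\<close>

lemma norm_scalar_mult_cart: "norm (a *s v) = norm a * norm (v :: complex^'n)"
  unfolding norm_vec_def by (simp add: norm_mult L2_set_right_distrib)

lemma of_real_scalar_mult_cart: "of_real r *s v = r *\<^sub>R (v :: complex^'n)"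
  by (simp add: vec_eq_iff scaleR_conv_of_real[where 'a = complex])

lemma bounded_linear_scalar_mult_right: "bounded_linear (\<lambda>v :: complex^'n. a *s v)"
  by (rule bounded_linear_intro[where K = "norm a"])
     (simp_all add: norm_scalar_mult_cart vector_add_ldistrib vec_eq_iff algebra_simps)

lemma bounded_linear_scalar_mult_left: "bounded_linear (\<lambda>a. a *s (v :: complex^'n))"
  by (rule bounded_linear_intro[where K = "norm v"])
     (simp_all add: norm_scalar_mult_cart vec_eq_iff algebra_simps)

lemma test_function_continuous: "f \<in> test_functions \<Longrightarrow> continuous_on UNIV f"
  unfolding test_functions_def smooth_def using Ck.simps(1) by blast

lemma test_function_periodic:
  assumes "f \<in> test_functions"
  shows "f (x + axis i (2 * pi * of_int n)) = f x"
proof -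
  have per: "f (x + axis i (2 * pi)) = f x" for x using assms by (simp add: test_functions_def)
  have nat: "f (x + axis i (2 * pi * real n)) = f x" for x n
  proof (induction n)
    case 0
    then show ?case by (simp add: axis_def vec_eq_iff zero_vec_def[symmetric] cong: if_cong)
  next
    case (Suc n)
    have "x + axis i (2 * pi * real (Suc n)) = (x + axis i (2 * pi * real n)) + axis i (2 * pi)"
      by (simp add: vec_eq_iff axis_def algebra_simps)
    then show ?case using per[of "x + axis i (2 * pi * real n)"] Suc by (simp only:)
  qed
  show ?thesis
  proof (cases "n \<ge> 0")
    case True
    then show ?thesis using nat[of x "nat n"] by simp
  next
    case False
    have "(x + axis i (2 * pi * of_int n)) + axis i (2 * pi * real (nat (- n))) = x"
      using False by (simp add: vec_eq_iff axis_def)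
    then show ?thesis using nat[of "x + axis i (2 * pi * of_int n)" "nat (- n)"] by (simp only:)
  qed
qed

lemma test_function_bounded:
  assumes f: "f \<in> test_functions"
  shows "\<exists>B. \<forall>x. norm (f x) \<le> B"
proof -
  have "compact (f ` cbox 0 (\<chi> i. 2 * pi))"
    by (intro compact_continuous_image continuous_on_subset[OF test_function_continuous[OF f]]) auto
  then have "bounded (f ` cbox 0 (\<chi> i. 2 * pi))" by (rule compact_imp_bounded)
  then obtain B where B: "\<And>x. x \<in> cbox 0 (\<chi> i. 2 * pi) \<Longrightarrow> norm (f x) \<le> B"
    unfolding bounded_iff by auto
  have "norm (f x) \<le> B" for x
  proof -
    \<comment> \<open>translate \<open>x\<close> into the period cell\<close>
    define n where "n i = - \<lfloor>x $ i / (2 * pi)\<rfloor>" for i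
    define y where "y = x + axis 1 (2 * pi * of_int (n 1)) + axis 2 (2 * pi * of_int (n 2)) + axis 3 (2 * pi * of_int (n 3))"
    have y: "y $ i = x $ i + 2 * pi * of_int (n i)" for i
    proof -
      have "\<forall>i. y $ i = x $ i + 2 * pi * of_int (n i)" unfolding forall_3 y_def by (simp add: axis_def)
      then show ?thesis ..
    qed
    have "0 \<le> y $ i \<and> y $ i \<le> 2 * pi" for i
    proof -
      define r where "r = x $ i / (2 * pi)"
      have "x $ i = 2 * pi * r" by (simp add: r_def)
      then have yr: "y $ i = 2 * pi * (r - of_int \<lfloor>r\<rfloor>)" by (simp add: y n_def r_def[symmetric] algebra_simps)
      have "0 \<le> r - of_int \<lfloor>r\<rfloor>" "r - of_int \<lfloor>r\<rfloor> \<le> 1" by linarith+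
      then show ?thesis unfolding yr by (auto intro: mult_left_le)
    qed
    then have "norm (f y) \<le> B" by (intro B) (simp add: mem_box_cart)
    then show ?thesis by (simp add: y_def test_function_periodic[OF f])
  qed
  then show ?thesis by blast
qed

text \<open>Boundedness of test functions is what makes the supremum of reals in \<open>cn_norm\<close> meaningful.\<close>

lemma norm_le_cn_norm:
  assumes "f \<in> test_functions" shows "norm (f x) \<le> cn_norm 0 f"
proof -
  obtain B where B: "\<And>x. norm (f x) \<le> B" using test_function_bounded[OF assms] by blast
  define \<phi> where "\<phi> = (\<lambda>(is, x). norm (foldr partial is f x))"
  have "\<phi> ([], x) \<le> (SUP p\<in>{is. length is \<le> 0} \<times> UNIV. \<phi> p)"
  proof (rule cSUP_upper)
    show "bdd_above (\<phi> ` ({is. length is \<le> 0} \<times> UNIV))"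
      by (rule bdd_aboveI2[where M = B]) (auto simp: \<phi>_def B)
  qed simp
  then show ?thesis by (simp add: \<phi>_def cn_norm_def case_prod_unfold)
qed

lemma layer_field_eq:
  assumes "c > 0" "q j > 0"
  shows "fourier_series (coeffs_U_q c q j) x + fourier_series (coeffs_U_q_minus_1 c q j) x
    = fourier_series (layer c q j) x"
proof -
  note fin = fourier_series_finite[OF finite_layer_support[where q = q and j = j, OF assms]]
  show ?thesis
    by (subst (1 2 3) fin) (auto simp: layer_outside layer_def vector_add_ldistrib sum.distrib)
qed

lemma continuous_layer_field:
  assumes "c > 0" "q j > 0"
  shows "continuous_on UNIV (fourier_series (layer c q j))"
  by (rule continuous_fourier_series[OF finite_layer_support[of c q j]]) (use assms in \<open>auto simp: layer_outside\<close>)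

text \<open>The \<open>L\<^sup>1\<close> norm is estimated through the \<open>L\<^sup>2\<close> norm, by integrating \<open>\<bar>u\<bar> \<le> t + \<bar>u\<bar>\<^sup>2 / t\<close>
  with a \<open>t\<close> that balances the two terms. The kernel bound is used at the scale \<open>L = lam (q j) / 4\<close>. There
  the frequencies of the layer satisfy \<open>1 \<le> \<bar>k\<bar> / L \<le> 8\<close>, and the profile \<open>h\<close> equals \<open>1\<close> for all of
  them.\<close>

lemma layer_L1_bound:
  assumes chi: "lp_cutoff chi"
  obtains K where "\<And>c q j. 0 < c \<Longrightarrow> c < 1 / 24 \<Longrightarrow> 0 < q j \<Longrightarrow>
    (LINT x|torus. norm (fourier_series (layer c q j) x)) \<le> K * lam (int (q j)) powr (- 1 / 2)"
proof -
  define h where "h \<xi> = chi ((1 / 16) *\<^sub>R \<xi>) - chi \<xi>" for \<xi>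
  have h_smooth: "smooth h"
    unfolding smooth_def h_def[abs_def]
    by (intro allI Ck_diff[OF Ck_scale]) (rule smoothD[OF lp_cutoffD(1)[OF chi]])+
  have h0: "h \<xi> = 0" if "norm \<xi> \<le> 1 / 2" for \<xi>
    using that lp_cutoffD(3)[OF chi] by (simp add: h_def)
  have h16: "h \<xi> = 0" if "norm \<xi> > 16" for \<xi>
    using that lp_cutoffD(4)[OF chi] by (simp add: h_def)
  obtain M where "M \<ge> 0" and M: "\<And>L c q j x. \<lbrakk>1 / 2 \<le> L; 0 < c; c < 1; 0 < q j;
      3 * c * lam (int (q j)) \<le> L; x \<in> cbox 0 (\<chi> i. 2 * pi)\<rbrakk> \<Longrightarrow>
      norm (fourier_series (\<lambda>k. h ((1 / L) *\<^sub>R of_lattice k) *\<^sub>R layer c q j k) x)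
        \<le> M / (lam (int (q j)))\<^sup>2 * (\<Prod>i\<in>UNIV. peak L (x $ i))"
    by (rule localized_layer_bound[where h = h and R = 16, OF chi h_smooth h0 h16]) (assumption, assumption, rule that)
  have h1: "h \<xi> = 1" if "1 \<le> norm \<xi>" "norm \<xi> \<le> 8" for \<xi>
    using that lp_cutoffD(3,4)[OF chi] by (simp add: h_def)
  define V where "V = (LINT x|torus. (1::real))"
  have "(LINT x|torus. norm (fourier_series (layer c q j) x)) \<le> (V + 8 * M\<^sup>2) * lam (int (q j)) powr (- 1 / 2)"
    if c: "0 < c" "c < 1 / 24" and q: "0 < q j" for c q j
  proof -
    define l where "l = lam (int (q j))"
    define L where "L = l / 4"
    define u where "u = fourier_series (layer c q j)"
    define t where "t = l powr (- 1 / 2)"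
    have "(2::real) ^ 1 \<le> 2 ^ q j" using q by (intro power_increasing) auto
    then have l: "l \<ge> 2" by (simp add: l_def lam_of_nat)
    have t: "t > 0" using l by (simp add: t_def)
    have u: "continuous_on UNIV u" unfolding u_def using c q by (intro continuous_layer_field)
    have loc: "h ((1 / L) *\<^sub>R of_lattice k) *\<^sub>R layer c q j k = layer c q j k" for k
    proof (cases "layer c q j k = 0")
      case False
      from layer_frequencies[OF c False] have "1 \<le> norm ((1 / L) *\<^sub>R of_lattice k)" "norm ((1 / L) *\<^sub>R of_lattice k) \<le> 8"
        using l unfolding l_def[symmetric] by (auto simp: L_def field_simps)
      then show ?thesis by (simp add: h1)
    qed simp
    have ub: "norm (u x) \<le> M / l\<^sup>2 * (\<Prod>i\<in>UNIV. peak L (x $ i))" if "x \<in> cbox 0 (\<chi> i. 2 * pi)" for x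
    proof -
      have "3 * c * l \<le> 1 / 8 * l" using c l by (intro mult_right_mono) auto
      then have side: "3 * c * lam (int (q j)) \<le> L" using l unfolding l_def[symmetric] L_def by linarith
      have "1 / 2 \<le> L" "c < 1" using l c by (auto simp: L_def)
      from M[where q = q and j = j, OF this(1) c(1) this(2) q side that] show ?thesis
        by (simp only: loc u_def l_def)
    qed
    have int1: "integrable torus (\<lambda>x. norm (u x))" and int2: "integrable torus (\<lambda>x. (norm (u x))\<^sup>2)"
      and int0: "integrable torus (\<lambda>x. t)"
      by (intro integrable_torus continuous_intros u)+
    have "ennreal (LINT x|torus. (norm (u x))\<^sup>2) = (\<integral>\<^sup>+ x. ennreal ((norm (u x))\<^sup>2) \<partial>torus)"
      by (rule nn_integral_eq_integral[symmetric]) (use int2 in auto)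
    also have "\<dots> = (\<integral>\<^sup>+ x. ennreal (norm (u x) powr 2) \<partial>torus)"
      by simp
    also have "\<dots> \<le> ennreal ((M / l\<^sup>2) powr 2 * (2 powr 2 * 2 / (2 - 1) * L powr (2 - 1)) ^ 3)"
      by (rule nn_integral_peak_product) (use l \<open>M \<ge> 0\<close> ub in \<open>auto simp: L_def\<close>)
    also have "(M / l\<^sup>2) powr 2 * (2 powr 2 * 2 / (2 - 1) * L powr (2 - 1)) ^ 3 = 8 * M\<^sup>2 / l"
      using l \<open>M \<ge> 0\<close> by (simp add: L_def power_divide power2_eq_square power3_eq_cube)
    finally have L2: "(LINT x|torus. (norm (u x))\<^sup>2) \<le> 8 * M\<^sup>2 / l"
      using l by (subst (asm) ennreal_le_iff) auto
    have "norm (u x) \<le> t + (norm (u x))\<^sup>2 / t" for x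
    proof -
      have "norm (u x) * t \<le> t * t + norm (u x) * norm (u x)"
      proof (cases "norm (u x) \<le> t")
        case True
        then show ?thesis using t by (intro add_increasing2) (auto intro: mult_right_mono)
      next
        case False
        then show ?thesis using t by (intro add_increasing) (auto intro: mult_left_mono)
      qed
      then show ?thesis using t by (simp add: field_simps power2_eq_square)
    qed
    then have "(LINT x|torus. norm (u x)) \<le> (LINT x|torus. t + (norm (u x))\<^sup>2 / t)"
      using int0 int1 int2 by (intro integral_mono) auto
    also have "\<dots> = t * V + (LINT x|torus. (norm (u x))\<^sup>2) / t"
      using int0 int2 by (simp add: V_def)
    also have "\<dots> \<le> t * V + (8 * M\<^sup>2 / l) / t"
      using L2 t by (intro add_left_mono divide_right_mono) auto
    also have "(8 * M\<^sup>2 / l) / t = 8 * M\<^sup>2 * t"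
    proof -
      have "l * (t * t) = l * l powr (- 1)" unfolding t_def powr_add[symmetric] by simp
      also have "\<dots> = 1" using l by (simp add: powr_minus)
      finally show ?thesis using l t by (simp add: field_simps)
    qed
    finally show ?thesis unfolding u_def t_def l_def by (simp add: algebra_simps)
  qed
  then show thesis by (rule that)
qed

text \<open>The \<open>L\<^sup>1\<close> norms of the layers are summable, since \<open>q j \<ge> j\<close>.\<close>

lemma U_is_distribution:
  assumes chi: "lp_cutoff chi" and c: "0 < c" "c < 1 / 24" and q: "\<And>j. 0 < q j" "strict_mono q"
  shows "is_distribution (U c q)"
proof -
  obtain K where K': "\<And>c q j. 0 < c \<Longrightarrow> c < 1 / 24 \<Longrightarrow> 0 < q j \<Longrightarrow>
    (LINT x|torus. norm (fourier_series (layer c q j) x)) \<le> K * lam (int (q j)) powr (- 1 / 2)"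
    by (rule layer_L1_bound[OF chi]) (rule that)
  note K = K'[where q = q, OF c q(1)]
  define u where "u j = fourier_series (layer c q j)" for j
  define \<rho> :: real where "\<rho> = 2 powr (- 1 / 2)"
  have \<rho>: "0 < \<rho>" "\<rho> < 1" by (auto simp: \<rho>_def intro!: powr_less_one)
  define I where "I j = (LINT x|torus. norm (u j x))" for j
  have I0: "I j \<ge> 0" for j unfolding I_def by (rule Bochner_Integration.integral_nonneg) simp
  have I: "I j \<le> \<bar>K\<bar> * \<rho> ^ j" for j
  proof -
    have "(2::real) ^ j \<le> lam (int (q j))"
      using strict_mono_imp_increasing[OF q(2), of j] unfolding lam_of_nat by (intro power_increasing) auto
    then have "lam (int (q j)) powr (- 1 / 2) \<le> (2 ^ j) powr (- 1 / 2)" by (intro powr_mono2') auto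
    also have "\<dots> = \<rho> ^ j" by (simp add: \<rho>_def powr_powr powr_realpow[symmetric] mult.commute)
    finally have "K * lam (int (q j)) powr (- 1 / 2) \<le> \<bar>K\<bar> * \<rho> ^ j" by (intro mult_mono) auto
    then show ?thesis using K[of j] unfolding I_def u_def by linarith
  qed
  have summ: "summable (\<lambda>j. \<bar>K\<bar> * \<rho> ^ j)" using \<rho> by (intro summable_mult summable_geometric) auto
  have sumI: "summable I" by (rule summable_comparison_test'[OF summ, of 0]) (use I I0 in auto)
  define T where "T j f = (LINT x|torus. f x *s u j x)" for j f
  have U: "U c q f = (\<Sum>j. T j f)" for f
    unfolding U_def distribution_of_def T_def u_def using c q(1) by (simp add: layer_field_eq)
  have ucont: "continuous_on UNIV (u j)" for j unfolding u_def using c q by (intro continuous_layer_field) auto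
  have int: "integrable torus (\<lambda>x. f x *s u j x)" if "f \<in> test_functions" for f j
    by (intro integrable_torus continuous_intros ucont test_function_continuous that)
  have Tb: "norm (T j f) \<le> cn_norm 0 f * I j" if f: "f \<in> test_functions" for f j
  proof -
    have "norm (T j f) \<le> (LINT x|torus. norm (f x *s u j x))" unfolding T_def by (rule integral_norm_bound)
    also have "\<dots> \<le> (LINT x|torus. cn_norm 0 f * norm (u j x))"
    proof (rule integral_mono)
      show "integrable torus (\<lambda>x. norm (f x *s u j x))" using int[OF f] by (rule integrable_norm)
      show "integrable torus (\<lambda>x. cn_norm 0 f * norm (u j x))" by (intro integrable_torus continuous_intros ucont)
      show "norm (f x *s u j x) \<le> cn_norm 0 f * norm (u j x)" for x
        unfolding norm_scalar_mult_cart by (intro mult_right_mono norm_le_cn_norm f) simp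
    qed
    also have "\<dots> = cn_norm 0 f * I j" by (simp add: I_def)
    finally show ?thesis .
  qed
  have sumT: "summable (\<lambda>j. norm (T j f))" if "f \<in> test_functions" for f
    by (rule summable_comparison_test'[OF summable_mult[OF sumI, of "cn_norm 0 f"], of 0]) (use Tb[OF that] in auto)
  note sumT' = summable_norm_cancel[OF sumT]
  show ?thesis
    unfolding is_distribution_def
  proof (intro conjI ballI allI exI[of _ "0::nat"] exI[of _ "\<Sum>j. I j"])
    fix f g assume f: "f \<in> test_functions" and g: "g \<in> test_functions"
    have "T j (\<lambda>x. f x + g x) = T j f + T j g" for j
      unfolding T_def vector_sadd_rdistrib using int f g by (intro Bochner_Integration.integral_add) auto
    then show "U c q (\<lambda>x. f x + g x) = U c q f + U c q g"
      unfolding U by (simp add: suminf_add[OF sumT'[OF f] sumT'[OF g]])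
  next
    fix f a assume f: "f \<in> test_functions"
    have "T j (\<lambda>x. a * f x) = a *s T j f" for j
      unfolding T_def using integral_bounded_linear[OF bounded_linear_scalar_mult_right int[OF f], of a j]
      by (simp add: vector_smult_assoc)
    then show "U c q (\<lambda>x. a * f x) = a *s U c q f"
      unfolding U by (simp add: bounded_linear.suminf[OF bounded_linear_scalar_mult_right sumT'[OF f]])
  next
    fix f assume f: "f \<in> test_functions"
    have "norm (U c q f) \<le> (\<Sum>j. norm (T j f))" unfolding U by (rule summable_norm[OF sumT[OF f]])
    also have "\<dots> \<le> (\<Sum>j. cn_norm 0 f * I j)"
      by (intro suminf_le Tb sumT f summable_mult sumI)
    also have "\<dots> = cn_norm 0 f * (\<Sum>j. I j)" by (rule suminf_mult[OF sumI])
    finally show "norm (U c q f) \<le> (\<Sum>j. I j) * cn_norm 0 f" by (simp add: mult.commute)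
  qed
qed

section \<open>Littlewood-Paley blocks\<close>

lemma distribution_of_layer_cis:
  assumes "c > 0" "q j > 0"
  shows "distribution_of (fourier_series (layer c q j)) (\<lambda>x. cis (- (of_lattice k \<bullet> x))) = (2 * pi) ^ 3 *\<^sub>R layer c q j k"
proof -
  define T where "T = layer_support c q j"
  have T: "finite T" unfolding T_def by (rule finite_layer_support[where q = q and j = j, OF assms])
  have diff: "of_lattice (l - k) = of_lattice l - of_lattice k" for l
    by (simp add: of_lattice_def vec_eq_iff)
  have fs: "fourier_series (layer c q j) x = (\<Sum>l\<in>T. cis (of_lattice l \<bullet> x) *s layer c q j l)" for x
    by (rule fourier_series_finite[OF T]) (simp add: T_def layer_outside)
  have "distribution_of (fourier_series (layer c q j)) (\<lambda>x. cis (- (of_lattice k \<bullet> x)))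
    = (LINT x|torus. (\<Sum>l\<in>T. cis (of_lattice (l - k) \<bullet> x) *s layer c q j l))"
    unfolding distribution_of_def fs
    by (simp add: vec.scale_sum_right vector_smult_assoc cis_mult diff inner_diff_left)
  also have "\<dots> = (\<Sum>l\<in>T. (LINT x|torus. cis (of_lattice (l - k) \<bullet> x) *s layer c q j l))"
    by (intro Bochner_Integration.integral_sum integrable_torus continuous_intros)
  also have "\<dots> = (\<Sum>l\<in>T. (LINT x|torus. cis (of_lattice (l - k) \<bullet> x)) *s layer c q j l)"
    by (intro sum.cong refl integral_bounded_linear[OF bounded_linear_scalar_mult_left] integrable_torus continuous_intros)
  also have "\<dots> = (\<Sum>l\<in>T. if l = k then (2 * pi) ^ 3 *\<^sub>R layer c q j k else 0)"
  proof (intro sum.cong refl)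
    show "(LINT x|torus. cis (of_lattice (l - k) \<bullet> x)) *s layer c q j l
      = (if l = k then (2 * pi) ^ 3 *\<^sub>R layer c q j k else 0)" for l
    proof (cases "l = k")
      case True
      then show ?thesis
        unfolding integral_torus_cis by (simp only: diff_self simp_thms if_True of_real_scalar_mult_cart)
    qed (simp add: integral_torus_cis)
  qed
  also have "\<dots> = (2 * pi) ^ 3 *\<^sub>R layer c q j k"
    using T by (simp add: T_def layer_outside)
  finally show ?thesis .
qed

text \<open>At a frequency that at most one layer contains, the series for the Fourier coefficient has at most
  one nonzero term.\<close>

lemma fourier_coeff_U:
  assumes c: "c > 0" and q: "\<And>j. q j > 0" and other: "\<And>j. j \<noteq> j0 \<Longrightarrow> layer c q j k = 0"
  shows "fourier_coeff (U c q) k = layer c q j0 k"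
proof -
  have "U c q (\<lambda>x. cis (- (of_lattice k \<bullet> x))) = (\<Sum>j. (2 * pi) ^ 3 *\<^sub>R layer c q j k)"
    unfolding U_def using c q by (simp add: layer_field_eq distribution_of_layer_cis)
  also have "\<dots> = (\<Sum>j\<in>{j0}. (2 * pi) ^ 3 *\<^sub>R layer c q j k)"
    by (rule suminf_finite) (use other in auto)
  finally show ?thesis by (simp add: fourier_coeff_def)
qed

lemma of_lattice_small:
  assumes "norm (of_lattice k) < 1" shows "k = 0"
proof -
  have "\<bar>real_of_int (k $ i)\<bar> < 1" for i
    using component_le_norm_cart[of "of_lattice k" i] assms by (simp add: of_lattice_def)
  then have "k $ i = 0" for i 
    by (smt (verit) of_int_less_1_iff of_int_minus)
  then show ?thesis by (simp add: vec_eq_iff)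
qed

text \<open>A layer seen by the block \<open>p\<close> satisfies \<open>lam p / 4 < lam (q j) < 8 lam p\<close>. As \<open>lam (q j) \<ge> 2\<close>,
  lacunarity with constant \<open>1 / 16\<close> makes consecutive scales differ by a factor greater than \<open>32\<close>, so two
  layers cannot both satisfy this.\<close>

lemma lp_block_U:
  assumes chi: "lp_cutoff chi" and c: "0 < c" "c < 1 / 24" and q: "\<And>j. 0 < q j" "strict_mono q"
    and lac: "\<And>j. (lam (int (q j)))\<^sup>2 / lam (int (q (Suc j))) < 1 / 16"
    and p: "p \<ge> - 1"
  shows "lp_block chi p (U c q) = (\<lambda>x. 0) \<or>
    (p \<ge> 0 \<and> (\<exists>j. lam p \<le> 4 * lam (int (q j)) \<and> lam (int (q j)) \<le> 8 * lam p \<and>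
      lp_block chi p (U c q) = fourier_series (\<lambda>k. lp_phi chi p (of_lattice k) *\<^sub>R layer c q j k)))"
proof (cases "\<exists>j k. lp_phi chi p (of_lattice k) *\<^sub>R layer c q j k \<noteq> 0")
  case False
  have "lp_phi chi p (of_lattice k) *\<^sub>R fourier_coeff (U c q) k = 0" for k
  proof (cases "lp_phi chi p (of_lattice k) = 0")
    case nz: False
    then have "layer c q j k = 0" for j using False by auto
    then show ?thesis using fourier_coeff_U[of c q 0 k] c q by simp
  qed simp
  then have "(\<lambda>k. lp_phi chi p (of_lattice k) *\<^sub>R fourier_coeff (U c q) k) = (\<lambda>k. 0)" by blast
  then have "lp_block chi p (U c q) = (\<lambda>x. 0)"
    by (intro ext) (simp only: lp_block_def fourier_series_def vector_smult_rzero infsum_0)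
  then show ?thesis ..
next
  case True
  then obtain j k where jk: "lp_phi chi p (of_lattice k) *\<^sub>R layer c q j k \<noteq> 0" by blast
  have two: "lam (int (q j)) \<ge> 2" for j
    using power_increasing[of 1 "q j" "2::real"] q(1)[of j] by (simp add: lam_of_nat)
  \<comment> \<open>the block \<open>- 1\<close> contains the frequency \<open>0\<close> only, which occurs in no layer\<close>
  have "p \<noteq> - 1"
  proof
    assume "p = - 1"
    then have "chi (of_lattice k) \<noteq> 0" using jk by (auto simp: lp_phi_def)
    then have "norm (of_lattice k) < 1" using lp_cutoffD(4)[OF chi] by force
    then have "k = 0" by (rule of_lattice_small)
    then have "norm (of_lattice k) = 0" by (simp add: of_lattice_def zero_vec_def[symmetric])
    moreover have "lam (int (q j)) / 4 \<le> norm (of_lattice k)"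
      using jk by (intro layer_frequencies(1)[OF c]) auto
    ultimately show False using two[of j] by simp
  qed
  then have p: "p \<ge> 0" using p by simp
  have freq: "lam p < 4 * lam (int (q j)) \<and> lam (int (q j)) < 8 * lam p"
    if "lp_phi chi p (of_lattice k) \<noteq> 0" "layer c q j k \<noteq> 0" for j k
  proof -
    define \<xi> where "\<xi> = (1 / lam p) *\<^sub>R of_lattice k"
    have phi: "chi (\<xi> /\<^sub>R 2) - chi \<xi> \<noteq> 0" using that(1) p by (simp add: lp_phi_def \<xi>_def)
    have n: "norm \<xi> = norm (of_lattice k) / lam p" using lam_pos[of p] by (simp add: \<xi>_def)
    have "norm \<xi> > 1 / 2"
    proof (rule ccontr)
      assume "\<not> norm \<xi> > 1 / 2"
      then show False using phi lp_cutoffD(3)[OF chi, of \<xi>] lp_cutoffD(3)[OF chi, of "\<xi> /\<^sub>R 2"] by simp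
    qed
    moreover have "norm \<xi> < 2"
    proof (rule ccontr)
      assume "\<not> norm \<xi> < 2"
      then show False using phi lp_cutoffD(4)[OF chi, of \<xi>] lp_cutoffD(4)[OF chi, of "\<xi> /\<^sub>R 2"] by simp
    qed
    ultimately have "lam p < 2 * norm (of_lattice k)" "norm (of_lattice k) < 2 * lam p"
      using lam_pos[of p] by (auto simp: n field_simps)
    then show ?thesis using layer_frequencies[OF c that(2)] by linarith
  qed
  have far: "32 * lam (int (q i)) < lam (int (q i'))" if "i < i'" for i i'
  proof -
    have "2 * lam (int (q i)) \<le> (lam (int (q i)))\<^sup>2"
      using two[of i] by (simp add: power2_eq_square)
    moreover have "16 * (lam (int (q i)))\<^sup>2 < lam (int (q (Suc i)))"
      using lac[of i] lam_pos[of "int (q (Suc i))"] by (simp add: field_simps)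
    moreover have "lam (int (q (Suc i))) \<le> lam (int (q i'))"
    proof -
      have "q (Suc i) \<le> q i'" using that q(2) by (simp add: strict_mono_less_eq)
      then show ?thesis unfolding lam_of_nat by (intro power_increasing) auto
    qed
    ultimately show ?thesis by linarith
  qed
  have fj: "lam p < 4 * lam (int (q j)) \<and> lam (int (q j)) < 8 * lam p" using jk by (intro freq[of k j]) auto
  have "lp_phi chi p (of_lattice l) *\<^sub>R fourier_coeff (U c q) l = lp_phi chi p (of_lattice l) *\<^sub>R layer c q j l" for l
  proof (cases "lp_phi chi p (of_lattice l) = 0")
    case nz: False
    have "layer c q i l = 0" if "i \<noteq> j" for i
    proof (rule ccontr)
      assume "layer c q i l \<noteq> 0"
      from freq[OF nz this] fj far[of i j] far[of j i] that show False by linarith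
    qed
    then show ?thesis using fourier_coeff_U[of c q j l] c q by simp
  qed simp
  then have "(\<lambda>l. lp_phi chi p (of_lattice l) *\<^sub>R fourier_coeff (U c q) l)
      = (\<lambda>l. lp_phi chi p (of_lattice l) *\<^sub>R layer c q j l)" by blast
  then have "lp_block chi p (U c q) = fourier_series (\<lambda>k. lp_phi chi p (of_lattice k) *\<^sub>R layer c q j k)"
    by (simp only: lp_block_def)
  then show ?thesis using p fj by (intro disjI2 conjI exI[of _ j]) auto
qed

theorem lemma3p1:
  fixes chi :: "real^3 \<Rightarrow> real"
  assumes "lp_cutoff chi"
  shows "\<exists>\<epsilon>0::real. \<exists>c0::real. \<epsilon>0 > 0 \<and> c0 > 0 \<and>
    (\<forall>\<epsilon> c. 0 < \<epsilon> \<and> \<epsilon> < \<epsilon>0 \<and> 0 < c \<and> c < c0 \<longrightarrow>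
      (\<forall>q::nat \<Rightarrow> nat.
        (\<forall>i. 0 < q i) \<and> strict_mono q \<and>
        (\<forall>i. (lam (int (q i)))\<^sup>2 / lam (int (q (Suc i))) < \<epsilon>) \<longrightarrow>
        (\<forall>r::ennreal. 1 < r \<and> r \<le> \<infinity> \<longrightarrow>
          U c q \<in> besov chi (enn2real (3 / r) - 1) r)))"
\<comment> \<open>\<open>1 / 16\<close> separates the layers. If \<open>c < 1 / 24\<close>, then the blocks of a layer with \<open>lam (q j) \<le> 8 L\<close> have
  sides at most \<open>3 c lam (q j) \<le> L\<close>.\<close>
proof (rule exI[of _ "1 / 16"], rule exI[of _ "1 / 24"], intro conjI allI impI)
  fix \<epsilon> c :: real and q :: "nat \<Rightarrow> nat" and r :: ennreal
  assume \<epsilon>c: "0 < \<epsilon> \<and> \<epsilon> < 1 / 16 \<and> 0 < c \<and> c < 1 / 24"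
    and q: "(\<forall>i. 0 < q i) \<and> strict_mono q \<and> (\<forall>i. (lam (int (q i)))\<^sup>2 / lam (int (q (Suc i))) < \<epsilon>)"
    and r: "1 < r \<and> r \<le> \<infinity>"
  from \<epsilon>c have c: "0 < c" "c < 1 / 24" by auto
  from q have q0: "\<And>i. 0 < q i" and mono: "strict_mono q" by auto
  have lac: "(lam (int (q i)))\<^sup>2 / lam (int (q (Suc i))) < 1 / 16" for i
  proof -
    have "(lam (int (q i)))\<^sup>2 / lam (int (q (Suc i))) < \<epsilon>" using q by blast
    also have "\<epsilon> < 1 / 16" using \<epsilon>c by blast
    finally show ?thesis .
  qed
  note chi = assms
  define s where "s = enn2real (3 / r)"
  define \<phi> where "\<phi> \<xi> = chi ((1 / 2) *\<^sub>R \<xi>) - chi \<xi>" for \<xi>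
  have phi_smooth: "smooth \<phi>"
    unfolding smooth_def \<phi>_def[abs_def]
    by (intro allI Ck_diff[OF Ck_scale]) (rule smoothD[OF lp_cutoffD(1)[OF chi]])+
  have phi0: "\<phi> \<xi> = 0" if "norm \<xi> \<le> 1 / 2" for \<xi>
    using that lp_cutoffD(3)[OF chi] by (simp add: \<phi>_def)
  have phi2: "\<phi> \<xi> = 0" if "norm \<xi> > 2" for \<xi>
    using that lp_cutoffD(4)[OF chi] by (simp add: \<phi>_def)
  obtain M where "M \<ge> 0" and M: "\<And>L c q j x. \<lbrakk>1 / 2 \<le> L; 0 < c; c < 1; 0 < q j;
      3 * c * lam (int (q j)) \<le> L; x \<in> cbox 0 (\<chi> i. 2 * pi)\<rbrakk> \<Longrightarrow>
      norm (fourier_series (\<lambda>k. \<phi> ((1 / L) *\<^sub>R of_lattice k) *\<^sub>R layer c q j k) x)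
        \<le> M / (lam (int (q j)))\<^sup>2 * (\<Prod>i\<in>UNIV. peak L (x $ i))"
    by (rule localized_layer_bound[where h = \<phi> and R = 2, OF chi phi_smooth phi0 phi2]) (assumption, assumption, rule that)
  obtain C where "C \<ge> 0" and C: "\<And>A L u. \<lbrakk>A \<ge> 0; L > 0; continuous_on UNIV u;
      \<forall>x\<in>cbox 0 (\<chi> i. 2 * pi). norm (u x) \<le> A * (\<Prod>i\<in>UNIV. peak L (x $ i))\<rbrakk> \<Longrightarrow>
      Lr_norm r u \<le> ennreal (C * A * L powr (3 - enn2real (3 / r)))"
    by (rule Lr_norm_peak_product[OF conjunct1[OF r]]) (rule that)
  note C = C[folded s_def]
  have "ennreal (lam p powr (s - 1)) * Lr_norm r (lp_block chi p (U c q)) \<le> ennreal (16 * C * M)"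
    if "p \<ge> - 1" for p
  proof (cases "lp_block chi p (U c q) = (\<lambda>x. 0)")
    case True
    have "Lr_norm r (\<lambda>x. 0) \<le> ennreal (C * 0 * 1 powr (3 - s))"
      by (rule C) auto
    then show ?thesis by (simp add: True)
  next
    case False
    define L where "L = lam p"
    from False lp_block_U[OF chi c q0 mono lac that] obtain j where p: "p \<ge> 0"
      and j: "L \<le> 4 * lam (int (q j))" "lam (int (q j)) \<le> 8 * L"
      and block: "lp_block chi p (U c q) = fourier_series (\<lambda>k. lp_phi chi p (of_lattice k) *\<^sub>R layer c q j k)"
      unfolding L_def by blast
    have "L \<ge> 1" using p one_le_power_int[of "2::real" p] by (simp add: L_def lam_def)
    have block': "lp_block chi p (U c q) = fourier_series (\<lambda>k. \<phi> ((1 / L) *\<^sub>R of_lattice k) *\<^sub>R layer c q j k)"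
      using p unfolding block by (simp add: lp_phi_def \<phi>_def L_def)
    have side: "3 * c * lam (int (q j)) \<le> L"
    proof -
      have "3 * c * lam (int (q j)) \<le> (1 / 8) * (8 * L)"
        using c j lam_pos[of "int (q j)"] by (intro mult_mono) auto
      then show ?thesis by simp
    qed
    have bound: "norm (lp_block chi p (U c q) x) \<le> 16 * M / L\<^sup>2 * (\<Prod>i\<in>UNIV. peak L (x $ i))"
      if x: "x \<in> cbox 0 (\<chi> i. 2 * pi)" for x
    proof -
      have "(L / 4)\<^sup>2 \<le> (lam (int (q j)))\<^sup>2" using j \<open>L \<ge> 1\<close> by (intro power_mono) auto
      then have "M / (lam (int (q j)))\<^sup>2 \<le> M / (L / 4)\<^sup>2"
        using \<open>M \<ge> 0\<close> \<open>L \<ge> 1\<close> lam_pos[of "int (q j)"] by (intro divide_left_mono) auto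
      then have "M / (lam (int (q j)))\<^sup>2 \<le> 16 * M / L\<^sup>2" by (simp add: power_divide mult.commute)
      moreover have "(\<Prod>i\<in>UNIV. peak L (x $ i)) \<ge> 0"
        using x \<open>L \<ge> 1\<close> by (intro prod_nonneg) (auto simp: mem_box_cart intro!: peak_nonneg)
      ultimately have "M / (lam (int (q j)))\<^sup>2 * (\<Prod>i\<in>UNIV. peak L (x $ i)) \<le> 16 * M / L\<^sup>2 * (\<Prod>i\<in>UNIV. peak L (x $ i))"
        by (rule mult_right_mono)
      then show ?thesis
        using M[of L c q j x] c q0 \<open>L \<ge> 1\<close> side x unfolding block' by force
    qed
    have cont: "continuous_on UNIV (lp_block chi p (U c q))"
      unfolding block
      by (rule continuous_fourier_series[OF finite_layer_support[where q = q and j = j, OF c(1) q0]]) (auto simp: layer_outside)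
    have "Lr_norm r (lp_block chi p (U c q)) \<le> ennreal (C * (16 * M / L\<^sup>2) * L powr (3 - s))"
      by (rule C[OF _ _ cont]) (use \<open>M \<ge> 0\<close> \<open>L \<ge> 1\<close> bound in auto)
    then have "ennreal (L powr (s - 1)) * Lr_norm r (lp_block chi p (U c q))
      \<le> ennreal (L powr (s - 1)) * ennreal (C * (16 * M / L\<^sup>2) * L powr (3 - s))"
      by (rule mult_left_mono) simp
    also have "\<dots> = ennreal (L powr (s - 1) * (C * (16 * M / L\<^sup>2) * L powr (3 - s)))"
      using \<open>M \<ge> 0\<close> \<open>C \<ge> 0\<close> by (subst ennreal_mult) auto
    also have "L powr (s - 1) * (C * (16 * M / L\<^sup>2) * L powr (3 - s)) = 16 * C * M"
    proof -
      have "L powr (s - 1) * L powr (3 - s) = L\<^sup>2"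
        using \<open>L \<ge> 1\<close> by (simp add: powr_add[symmetric])
      then show ?thesis using \<open>L \<ge> 1\<close> by (simp add: field_simps)
    qed
    finally show ?thesis unfolding L_def .
  qed
  then have "besov_norm chi (s - 1) r (U c q) \<le> ennreal (16 * C * M)"
    unfolding besov_norm_def by (intro SUP_least) auto
  also have "\<dots> < \<infinity>" by simp
  finally show "U c q \<in> besov chi (enn2real (3 / r) - 1) r"
    unfolding besov_def s_def[symmetric] using U_is_distribution[OF chi c q0 mono] by simp
qed auto

end
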